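(* Consider the single-player restless multi-armed bandit with $N$ arms in which $M$ arms are played at each time, $1<M<N$. Assume that the transition matrices $\{P_i\}_{i=1}^N$ are finite state, irreducible, aperiodic and reversible, and that all reward states are non-negative. For any increasing sequence $f(t)$ with $f(t)\to\infty$ as $t\to\infty$, if the DSEE policy $\Phi$ is run with the time-varying parameter $D(t)=f(t)$, then $$r_\Phi(t)=O(f(t)\log t)\quad\text{as } t\to\infty.$$
   Context: Model. There are $N$ independent arms and one player, who can play $M$ arms at each time $t=1,2,\dots$. Arm $j$ has state space $\mathcal S_j$, a finite set of real numbers; its state at time $t$ is $s_j(t)\in\mathcal S_j$. When arm $j$ is played at time $t$ the player observes and receives the reward $s_j(t)$, and the state of arm $j$ then changes according to a Markovian rule with transition matrix $P_j$ (unknown to the player). When arm $j$ is not played (passive), its state evolves according to an arbitrary unknown random process. $\vec\pi_j=\{\pi_j(s)\}_{s\in\mathcal S_j}$ is the stationary distribution of $P_j$, and $\mu_j=\sum_{s\in\mathcal S_j}s\,\pi_j(s)$. $\sigma$ is a permutation of $\{1,\dots,N\}$ with $\mu_{\sigma(1)}\ge\mu_{\sigma(2)}\ge\dots\ge\mu_{\sigma(N)}$. Regret. With $T_j(t)$ the number of plays of arm $j$ by time $t$ and $t_j(n)$ the time of the $n$th play of arm $j$, the total reward is $R(t)=\sum_{j=1}^N\sum_{n=1}^{T_j(t)}s_j(t_j(n))$, and the regret of a policy $\Phi$ is $r_\Phi(t)=t\sum_{i=1}^M\mu_{\sigma(i)}-\mathbb E_\Phi[R(t)]+O(1)$, the $O(1)$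 constant (transient effect of the initial states of the $M$ best arms) not affecting the order. DSEE policy with parameter $D(t)$. Time is partitioned into exploration and exploitation epochs. In the $n$th exploration epoch (length $\lceil N/M\rceil4^{n-1}$) each arm is played for $4^{n-1}$ consecutive times (the $N$ arms being distributed over $\lceil N/M\rceil$ blocks of $4^{n-1}$ slots, at most $M$ arms per block), and the remaining $(M\lceil N/M\rceil-N)4^{n-1}$ plays are given up (no arm played, no reward). In the $n$th exploitation epoch (length $2\times4^{n-1}$) the player plays throughout the $M$ arms with the $M$ largest sample means (average reward per play, computed at the beginning of this epoch from all observations obtained so far in exploration and exploitation epochs). The first epoch, starting at $t=1$, is an exploration epoch. Whenever an epoch has ended and the next is to start at time $t$, let $n_O$ be the number of exploration epochs so far and $X_O(t)=(4^{n_O}-1)/3$ the time spent on each arm in exploration epochs so far; if $X_O(t)>D(t)\log t$ the next epoch is an exploitation epoch, otherwise it is an exploration epoch. $\log$ is the natural logarithm. *)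

theory Defs
  imports
    "HOL-Probability.Probability"
    "HOL-Combinatorics.Permutations"
    "HOL-Library.Landau_Symbols"
begin

section \<open>Finite Markov chains on a set of real states\<close>

text \<open>
  A transition matrix on \<open>S\<close> is a kernel \<open>P\<close>; its entries are \<open>pmf (P s) s'\<close>. The row-sum
  condition is built into the type \<open>pmf\<close>.
\<close>

definition transition_matrix :: "real set \<Rightarrow> (real \<Rightarrow> real pmf) \<Rightarrow> bool" where
  "transition_matrix S P \<longleftrightarrow> (\<forall>s\<in>S. set_pmf (P s) \<subseteq> S)"

primrec steps :: "(real \<Rightarrow> real pmf) \<Rightarrow> nat \<Rightarrow> real \<Rightarrow> real pmf" where
  "steps P 0 s = return_pmf s"
| "steps P (Suc n) s = bind_pmf (steps P n s) P"

definition irreducible_chain :: "real set \<Rightarrow> (real \<Rightarrow> real pmf) \<Rightarrow> bool" where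
  "irreducible_chain S P \<longleftrightarrow> (\<forall>s\<in>S. \<forall>s'\<in>S. \<exists>n. pmf (steps P n s) s' > 0)"

definition aperiodic_chain :: "real set \<Rightarrow> (real \<Rightarrow> real pmf) \<Rightarrow> bool" where
  "aperiodic_chain S P \<longleftrightarrow> (\<forall>s\<in>S. Gcd {n. n > 0 \<and> pmf (steps P n s) s > 0} = 1)"

definition stationary_distribution :: "real set \<Rightarrow> (real \<Rightarrow> real pmf) \<Rightarrow> real pmf \<Rightarrow> bool" where
  "stationary_distribution S P \<pi> \<longleftrightarrow> set_pmf \<pi> \<subseteq> S \<and> bind_pmf \<pi> P = \<pi>"

definition reversible_chain :: "real set \<Rightarrow> (real \<Rightarrow> real pmf) \<Rightarrow> real pmf \<Rightarrow> bool" where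
  "reversible_chain S P \<pi> \<longleftrightarrow>
     (\<forall>s\<in>S. \<forall>s'\<in>S. pmf \<pi> s * pmf (P s) s' = pmf \<pi> s' * pmf (P s') s)"

definition mean_reward :: "real set \<Rightarrow> real pmf \<Rightarrow> real" where
  "mean_reward S \<pi> = (\<Sum>s\<in>S. s * pmf \<pi> s)"


section \<open>The restless bandit\<close>

text \<open>
  Arms are numbered \<open>1, \<dots>, N\<close> and time starts at \<open>1\<close>. A history of length \<open>t\<close> is a list whose
  entry with list index \<open>\<tau> - 1\<close> contains the state vector \<open>(s\<^sub>j(\<tau>))\<^sub>j\<close> and the set of arms played
  at time \<open>\<tau>\<close>. The player only sees the observations: the partial map sending each played arm
  to its state (= its reward). A policy chooses the set of arms to play next from the
  observations made so far.
\<close>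

type_synonym history = "((nat \<Rightarrow> real) \<times> nat set) list"
type_synonym observation = "nat \<Rightarrow> real option"
type_synonym policy = "observation list \<Rightarrow> nat set"

definition observations :: "history \<Rightarrow> observation list" where
  "observations h = map (\<lambda>(x, A). (\<lambda>j. Some (x j)) |` A) h"

text \<open>The own past of arm \<open>j\<close>: its states, each with a flag telling whether it was played.\<close>

definition arm_past :: "nat \<Rightarrow> history \<Rightarrow> (real \<times> bool) list" where
  "arm_past j h = map (\<lambda>(x, A). (x j, j \<in> A)) h"

text \<open>
  Law of the next state of an arm given its own past: the initial law \<open>\<iota>\<close>, then \<open>P\<close> applied to the
  last state if the arm was just played, and otherwise the passive kernel \<open>Q\<close>. The latter may depend
  on the whole past of the arm (in particular, through its length, on time), so that it can be the
  conditional law of an arbitrary random process.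
\<close>

definition arm_next ::
  "real pmf \<Rightarrow> (real \<Rightarrow> real pmf) \<Rightarrow> ((real \<times> bool) list \<Rightarrow> real pmf) \<Rightarrow> (real \<times> bool) list \<Rightarrow> real pmf"
where
  "arm_next \<iota> P Q p =
     (if p = [] then \<iota> else if snd (last p) then P (fst (last p)) else Q p)"

text \<open>
  Joint law of the history up to time \<open>t\<close> under the policy \<open>\<phi>\<close>. The product law \<open>Pi_pmf\<close> makes the
  arms independent: they interact only through the choices of the player.
\<close>

primrec bandit_law ::
  "nat \<Rightarrow> (nat \<Rightarrow> real pmf) \<Rightarrow> (nat \<Rightarrow> real \<Rightarrow> real pmf)
     \<Rightarrow> (nat \<Rightarrow> (real \<times> bool) list \<Rightarrow> real pmf) \<Rightarrow> policy \<Rightarrow> nat \<Rightarrow> history pmf"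
where
  "bandit_law N \<iota> P Q \<phi> 0 = return_pmf []"
| "bandit_law N \<iota> P Q \<phi> (Suc t) =
     bind_pmf (bandit_law N \<iota> P Q \<phi> t) (\<lambda>h.
       map_pmf (\<lambda>x. h @ [(x, \<phi> (observations h))])
         (Pi_pmf {1..N} 0 (\<lambda>j. arm_next (\<iota> j) (P j) (Q j) (arm_past j h))))"

text \<open>
  The successive rewards \<open>s\<^sub>j(t\<^sub>j(1)), s\<^sub>j(t\<^sub>j(2)), \<dots>\<close> collected from arm \<open>j\<close>; the length of this list
  is the number \<open>T\<^sub>j\<close> of plays.
\<close>

definition rewards :: "nat \<Rightarrow> observation list \<Rightarrow> real list" where
  "rewards j os = List.map_filter (\<lambda>ob. ob j) os"

definition total_reward :: "nat \<Rightarrow> history \<Rightarrow> real" where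
  "total_reward N h = (\<Sum>j=1..N. sum_list (rewards j (observations h)))"

text \<open>
  \<open>r\<close> is a regret function of \<open>\<phi>\<close>: the regret is only specified up to a bounded additive term.
  Here \<open>\<sigma>\<close> sorts the arms by decreasing mean reward \<open>\<mu>\<close>.
\<close>

definition is_regret ::
  "nat \<Rightarrow> nat \<Rightarrow> (nat \<Rightarrow> real) \<Rightarrow> (nat \<Rightarrow> nat) \<Rightarrow> (nat \<Rightarrow> real pmf) \<Rightarrow> (nat \<Rightarrow> real \<Rightarrow> real pmf)
     \<Rightarrow> (nat \<Rightarrow> (real \<times> bool) list \<Rightarrow> real pmf) \<Rightarrow> policy \<Rightarrow> (nat \<Rightarrow> real) \<Rightarrow> bool"
where
  "is_regret N M \<mu> \<sigma> \<iota> P Q \<phi> r \<longleftrightarrow>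
     (\<lambda>t. r t - (real t * (\<Sum>i=1..M. \<mu> (\<sigma> i))
                 - measure_pmf.expectation (bandit_law N \<iota> P Q \<phi> t) (total_reward N)))
     \<in> O(\<lambda>_. 1)"


section \<open>The DSEE policy\<close>

definition num_blocks :: "nat \<Rightarrow> nat \<Rightarrow> nat" where
  "num_blocks N M = nat \<lceil>real N / real M\<rceil>"

text \<open>
  The epoch to start at time \<open>t\<close>, after \<open>a\<close> exploration epochs, is an exploitation epoch iff
  \<open>X\<^sub>O(t) > D(t) log t\<close>. For \<open>t = 1\<close>, \<open>a = 0\<close> this reads \<open>0 > 0\<close>, so the first epoch is an
  exploration epoch.
\<close>

definition exploits :: "(nat \<Rightarrow> real) \<Rightarrow> nat \<Rightarrow> nat \<Rightarrow> bool" where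
  "exploits D t a \<longleftrightarrow> (4 ^ a - 1) / 3 > D t * ln (real t)"

text \<open>
  Epoch number \<open>k\<close> (from \<open>0\<close>): its starting time and the numbers of exploration and of
  exploitation epochs before it. The \<open>n\<close>-th epoch of a kind is thus the one with counter \<open>n - 1\<close>.
\<close>

primrec epoch :: "nat \<Rightarrow> nat \<Rightarrow> (nat \<Rightarrow> real) \<Rightarrow> nat \<Rightarrow> nat \<times> nat \<times> nat" where
  "epoch N M D 0 = (1, 0, 0)"
| "epoch N M D (Suc k) =
     (case epoch N M D k of (t, a, b) \<Rightarrow>
        if exploits D t a then (t + 2 * 4 ^ b, a, Suc b)
        else (t + num_blocks N M * 4 ^ a, Suc a, b))"

definition epoch_at :: "nat \<Rightarrow> nat \<Rightarrow> (nat \<Rightarrow> real) \<Rightarrow> nat \<Rightarrow> nat \<times> nat \<times> nat" where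
  "epoch_at N M D t = epoch N M D (LEAST k. t < fst (epoch N M D (Suc k)))"

definition sample_mean :: "nat \<Rightarrow> observation list \<Rightarrow> real" where
  "sample_mean j os = sum_list (rewards j os) / real (length (rewards j os))"

text \<open>
  The description of the policy leaves open how the arms are distributed over the blocks of the
  exploration epochs (\<open>block n j\<close> is the block of arm \<open>j\<close> in the \<open>n\<close>-th one, blocks being numbered
  from \<open>0\<close>) and how ties between sample means are broken (\<open>best os\<close> is some set of \<open>M\<close> arms with
  the largest sample means). Both are parameters.
\<close>

definition block_assignment :: "nat \<Rightarrow> nat \<Rightarrow> (nat \<Rightarrow> nat \<Rightarrow> nat) \<Rightarrow> bool" where
  "block_assignment N M block \<longleftrightarrow>
     (\<forall>n. (\<forall>j\<in>{1..N}. block n j < num_blocks N M) \<and>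
          (\<forall>i. card {j\<in>{1..N}. block n j = i} \<le> M))"

definition best_selection :: "nat \<Rightarrow> nat \<Rightarrow> (observation list \<Rightarrow> nat set) \<Rightarrow> bool" where
  "best_selection N M best \<longleftrightarrow>
     (\<forall>os. best os \<subseteq> {1..N} \<and> card (best os) = M \<and>
           (\<forall>i\<in>best os. \<forall>j\<in>{1..N} - best os. sample_mean j os \<le> sample_mean i os))"

text \<open>
  In an exploitation epoch starting at \<open>t\<^sub>0\<close>, the sample means use the observations made before \<open>t\<^sub>0\<close>,
  so the same \<open>M\<close> arms are played throughout the epoch.
\<close>

definition dsee ::
  "nat \<Rightarrow> nat \<Rightarrow> (nat \<Rightarrow> real) \<Rightarrow> (nat \<Rightarrow> nat \<Rightarrow> nat) \<Rightarrow> (observation list \<Rightarrow> nat set) \<Rightarrow> policy"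
where
  "dsee N M D block best os =
     (let t = Suc (length os) in
      case epoch_at N M D t of (t\<^sub>0, a, b) \<Rightarrow>
        if exploits D t\<^sub>0 a then best (take (t\<^sub>0 - 1) os)
        else {j\<in>{1..N}. block (Suc a) j = (t - t\<^sub>0) div 4 ^ a})"

end

theory Submission
  imports Defs
begin

text \<open>
The regret has two sources: playing inferior arms, and the transients by which the rewards of a
played arm deviate from its stationary mean.

The transients are controlled by the Poisson equation. If \<open>g\<close> satisfies \<open>g - P g = id - \<mu>\<close> on the
states of an arm (lemma \<open>poisson_equation\<close>), then over a run of consecutive plays the sum of the
centred rewards \<open>x - \<mu>\<close> is a martingale with bounded differences plus two boundary terms, which are
bounded by the size of \<open>g\<close>. This holds from any initial state of the run, so the arbitrary evolution
of passive arms does no harm, and the error is proportional to the number of runs. Runs begin and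
end only at block boundaries of the epochs, whose times are deterministic; as epoch lengths grow
geometrically, only \<open>O(ln t)\<close> of them lie before \<open>t\<close> (\<open>switch_times_bound\<close>). Hence the expected
reward is the expected sum of the mean rewards of the played arms, up to \<open>O(ln t)\<close>
(\<open>expected_total_reward\<close>).

Inferior arms are played, first, in the exploration epochs. An exploration epoch starts only while
the exploration time per arm is below \<open>f t * ln t\<close>, and it multiplies this time by about 4, so the
exploration time is \<open>O(f t * ln t)\<close> (\<open>exploration_time_bound\<close>). This is the dominant term.

Second, an exploitation epoch may use a wrong set of arms. When it starts at time \<open>s\<close>, every arm has
been played more than \<open>f s * ln s\<close> times. The martingale above has an exponential supermartingale
whose variance term counts the random number of plays (\<open>exponential_supermartingale\<close>), which yields
that a sample mean is off by \<open>\<delta>\<close> with probability at most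
\<open>2 * exp (- c * \<delta>\<^sup>2 * f s * ln s)\<close>. As \<open>f\<close> diverges, this is eventually at most \<open>2 / s\<close>, however small the
constants \<open>c\<close> and \<open>\<delta>\<close> that belong to the unknown arms (\<open>wrong_selection_probability\<close>). The epoch ends
by time \<open>4 * s\<close>, so the slot at time \<open>t\<close> loses \<open>O(1 / t)\<close> on average, and the harmonic sum of these
losses is \<open>O(ln t)\<close>.
\<close>

section \<open>Finitely supported laws\<close>

lemma expectation_bind_finite:
  fixes h :: "'b \<Rightarrow> real"
  assumes "finite (set_pmf p)" and "\<And>x. x \<in> set_pmf p \<Longrightarrow> finite (set_pmf (f x))"
  shows "measure_pmf.expectation (bind_pmf p f) h
    = measure_pmf.expectation p (\<lambda>x. measure_pmf.expectation (f x) h)"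
proof -
  have "measure_pmf.expectation (bind_pmf p f) h
      = (\<Sum>a\<in>set_pmf p. pmf p a *\<^sub>R measure_pmf.expectation (f a) h)"
    using assms by (intro pmf_expectation_bind) auto
  also have "\<dots> = measure_pmf.expectation p (\<lambda>x. measure_pmf.expectation (f x) h)"
    using assms(1) by (subst integral_measure_pmf_real[of "set_pmf p"]) (auto simp: mult.commute)
  finally show ?thesis .
qed

lemma expectation_mono_finite:
  fixes f g :: "'a \<Rightarrow> real"
  assumes "finite (set_pmf p)" and "\<And>x. x \<in> set_pmf p \<Longrightarrow> f x \<le> g x"
  shows "measure_pmf.expectation p f \<le> measure_pmf.expectation p g"
  using assms by (intro integral_mono_AE integrable_measure_pmf_finite) (auto simp: AE_measure_pmf_iff)

lemma expectation_cong:
  fixes f g :: "'a \<Rightarrow> real"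
  assumes "\<And>x. x \<in> set_pmf p \<Longrightarrow> f x = g x"
  shows "measure_pmf.expectation p f = measure_pmf.expectation p g"
  using assms by (intro integral_cong_AE) (auto simp: AE_measure_pmf_iff)

lemma expectation_le_const_finite:
  fixes f :: "'a \<Rightarrow> real"
  assumes "finite (set_pmf p)" and "\<And>x. x \<in> set_pmf p \<Longrightarrow> f x \<le> c"
  shows "measure_pmf.expectation p f \<le> c"
  using expectation_mono_finite[OF assms(1), of f "\<lambda>_. c"] assms(2) by simp

lemma abs_expectation_le_finite:
  fixes f :: "'a \<Rightarrow> real"
  assumes fin: "finite (set_pmf p)" and bnd: "\<And>x. x \<in> set_pmf p \<Longrightarrow> \<bar>f x\<bar> \<le> c"
  shows "\<bar>measure_pmf.expectation p f\<bar> \<le> c"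
proof (rule abs_leI)
  show "measure_pmf.expectation p f \<le> c"
    using bnd by (intro expectation_le_const_finite[OF fin]) (force simp: abs_le_iff)
  have "measure_pmf.expectation p (\<lambda>x. - f x) \<le> c"
    using bnd by (intro expectation_le_const_finite[OF fin]) (force simp: abs_le_iff)
  thus "- measure_pmf.expectation p f \<le> c" by simp
qed

lemma expectation_eq_sum:
  fixes f :: "real \<Rightarrow> real"
  assumes "finite S" "set_pmf p \<subseteq> S"
  shows "measure_pmf.expectation p f = (\<Sum>y\<in>S. f y * pmf p y)"
  using assms by (intro integral_measure_pmf_real) auto

section \<open>The Poisson equation of a finite irreducible chain\<close>

text \<open>
Doeblin's argument: subtract from every row of the kernel the common part of mass \<open>\<epsilon>\<close> at each
state. That part contributes the same constant to all averages, and the remaining mass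
\<open>1 - \<epsilon> * card S\<close> scales the oscillation.
\<close>

lemma averaging_contracts_oscillation:
  fixes u :: "real \<Rightarrow> real"
  assumes S: "finite S"
    and R: "\<And>x. x \<in> S \<Longrightarrow> set_pmf (R x) \<subseteq> S"
    and eps: "\<And>x y. x \<in> S \<Longrightarrow> y \<in> S \<Longrightarrow> \<epsilon> \<le> pmf (R x) y"
    and u: "\<And>x. x \<in> S \<Longrightarrow> a \<le> u x \<and> u x \<le> a + d"
  shows "\<exists>a'. \<forall>x\<in>S. a' \<le> measure_pmf.expectation (R x) u
            \<and> measure_pmf.expectation (R x) u \<le> a' + (1 - \<epsilon> * card S) * d"
proof (intro exI ballI)
  fix x assume x: "x \<in> S"
  let ?a = "a + \<epsilon> * (\<Sum>y\<in>S. u y - a)"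
  have one: "(\<Sum>y\<in>S. pmf (R x) y) = 1"
    using S R[OF x] by (intro sum_pmf_eq_1) auto
  have "measure_pmf.expectation (R x) u = (\<Sum>y\<in>S. u y * pmf (R x) y)"
    by (rule expectation_eq_sum[OF S R[OF x]])
  also have "\<dots> = (\<Sum>y\<in>S. a * pmf (R x) y + \<epsilon> * (u y - a) + (u y - a) * (pmf (R x) y - \<epsilon>))"
    by (intro sum.cong) (auto simp: algebra_simps)
  also have "\<dots> = ?a + (\<Sum>y\<in>S. (u y - a) * (pmf (R x) y - \<epsilon>))"
    by (simp add: sum.distrib sum_distrib_left[symmetric] one)
  finally have eq: "measure_pmf.expectation (R x) u
      = ?a + (\<Sum>y\<in>S. (u y - a) * (pmf (R x) y - \<epsilon>))" .
  have "0 \<le> (\<Sum>y\<in>S. (u y - a) * (pmf (R x) y - \<epsilon>))"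
    using u eps[OF x] by (intro sum_nonneg mult_nonneg_nonneg) auto
  moreover have "(\<Sum>y\<in>S. (u y - a) * (pmf (R x) y - \<epsilon>)) \<le> (\<Sum>y\<in>S. d * (pmf (R x) y - \<epsilon>))"
    using u eps[OF x] by (intro sum_mono mult_right_mono) (auto simp: algebra_simps)
  moreover have "(\<Sum>y\<in>S. d * (pmf (R x) y - \<epsilon>)) = (1 - \<epsilon> * card S) * d"
    by (simp add: sum_distrib_left[symmetric] sum_subtractf one)
  ultimately show "?a \<le> measure_pmf.expectation (R x) u
      \<and> measure_pmf.expectation (R x) u \<le> ?a + (1 - \<epsilon> * card S) * d"
    using eq by simp
qed

text \<open>
The solution is the Neumann series \<open>h = \<Sum>n. R\<^sup>n v\<close>. It converges geometrically: the oscillation of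
\<open>R\<^sup>n v\<close> shrinks by averaging, and a function with mean zero is bounded by its oscillation.
\<close>

lemma poisson_equation_positive_kernel:
  fixes v :: "real \<Rightarrow> real"
  assumes S: "finite S" "S \<noteq> {}"
    and R: "\<And>x. x \<in> S \<Longrightarrow> set_pmf (R x) \<subseteq> S"
    and eps: "\<And>x y. x \<in> S \<Longrightarrow> y \<in> S \<Longrightarrow> \<epsilon> \<le> pmf (R x) y" "\<epsilon> > 0"
    and p: "set_pmf p \<subseteq> S" "bind_pmf p R = p"
    and v: "measure_pmf.expectation p v = 0"
  shows "\<exists>h. \<forall>x\<in>S. h x - measure_pmf.expectation (R x) h = v x"
proof -
  define c where "c = 1 - \<epsilon> * card S"
  define u where "u n = ((\<lambda>w x. measure_pmf.expectation (R x) w) ^^ n) v" for n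
  have u0: "u 0 = v" by (simp add: u_def)
  have uS: "u (Suc n) x = measure_pmf.expectation (R x) (u n)" for n x
    by (simp add: u_def)
  have finR: "finite (set_pmf (R x))" if "x \<in> S" for x
    using R[OF that] S by (meson finite_subset)
  have finp: "finite (set_pmf p)" using p S by (meson finite_subset)
  have c1: "c < 1" using S eps(2) by (simp add: c_def card_gt_0_iff)
  obtain x0 where x0: "x0 \<in> S" using S by blast
  have "(\<Sum>y\<in>S. \<epsilon>) \<le> (\<Sum>y\<in>S. pmf (R x0) y)"
    using eps x0 by (intro sum_mono) auto
  also have "\<dots> = 1" using S R[OF x0] by (intro sum_pmf_eq_1) auto
  finally have c0: "0 \<le> c" by (simp add: c_def mult.commute)
  define D where "D = Max (v ` S) - Min (v ` S)"
  have osc: "\<exists>a. \<forall>x\<in>S. a \<le> u n x \<and> u n x \<le> a + c ^ n * D" for n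
  proof (induction n)
    case 0
    show ?case using S by (intro exI[of _ "Min (v ` S)"]) (auto simp: u0 D_def)
  next
    case (Suc n)
    then obtain a where a: "\<And>x. x \<in> S \<Longrightarrow> a \<le> u n x \<and> u n x \<le> a + c ^ n * D" by blast
    show ?case
      using averaging_contracts_oscillation[where u = "u n" and R = R, OF S(1) R eps(1) a]
      by (simp add: uS c_def mult.assoc)
  qed
  have mean: "measure_pmf.expectation p (u n) = 0" for n
  proof (induction n)
    case (Suc n)
    have "measure_pmf.expectation p (u (Suc n)) = measure_pmf.expectation (bind_pmf p R) (u n)"
      unfolding uS using p finR by (subst expectation_bind_finite[OF finp]) auto
    thus ?case using Suc p by simp
  qed (simp add: u0 v)
  have bnd: "\<bar>u n x\<bar> \<le> c ^ n * D" if "x \<in> S" for n x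
  proof -
    obtain a where a: "\<And>x. x \<in> S \<Longrightarrow> a \<le> u n x \<and> u n x \<le> a + c ^ n * D" using osc by blast
    have "measure_pmf.expectation p (u n) \<le> a + c ^ n * D"
      using a p by (intro expectation_le_const_finite[OF finp]) auto
    moreover have "measure_pmf.expectation p (\<lambda>x. - u n x) \<le> - a"
      using a p by (intro expectation_le_const_finite[OF finp]) auto
    ultimately show ?thesis using a[OF that] mean[of n] by auto
  qed
  have summ: "summable (\<lambda>n. u n x)" if "x \<in> S" for x
  proof (rule summable_comparison_test')
    show "summable (\<lambda>n. c ^ n * D)" using c0 c1 by (intro summable_mult2 summable_geometric) auto
    show "norm (u n x) \<le> c ^ n * D" if "0 \<le> n" for n using bnd[OF \<open>x \<in> S\<close>] by simp
  qed
  define h where "h x = (\<Sum>n. u n x)" for x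
  show ?thesis
  proof (intro exI ballI)
    fix x assume x: "x \<in> S"
    have "measure_pmf.expectation (R x) h = (\<Sum>y\<in>S. h y * pmf (R x) y)"
      by (rule expectation_eq_sum[OF S(1) R[OF x]])
    also have "\<dots> = (\<Sum>y\<in>S. \<Sum>n. u n y * pmf (R x) y)"
      unfolding h_def using summ by (intro sum.cong) (auto simp: suminf_mult2)
    also have "\<dots> = (\<Sum>n. \<Sum>y\<in>S. u n y * pmf (R x) y)"
      using summ by (intro suminf_sum[symmetric]) (auto intro: summable_mult2)
    also have "\<dots> = (\<Sum>n. u (Suc n) x)"
      by (simp add: uS expectation_eq_sum[OF S(1) R[OF x]])
    also have "\<dots> = h x - u 0 x"
      unfolding h_def by (rule suminf_split_head[OF summ[OF x]])
    finally show "h x - measure_pmf.expectation (R x) h = v x" by (simp add: u0)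
  qed
qed

lemma set_steps_subset:
  assumes "transition_matrix S P" "x \<in> S"
  shows "set_pmf (steps P n x) \<subseteq> S"
  using assms by (induction n) (auto simp: transition_matrix_def)

lemma steps_Suc_front: "steps P (Suc n) x = bind_pmf (P x) (steps P n)"
proof (induction n)
  case 0
  show ?case by (simp add: bind_return_pmf bind_return_pmf')
next
  case (Suc n)
  have "steps P (Suc (Suc n)) x = bind_pmf (bind_pmf (P x) (steps P n)) P"
    using Suc by simp
  thus ?case by (simp add: bind_assoc_pmf)
qed

lemma bind_steps_stationary:
  assumes "bind_pmf p P = p" shows "bind_pmf p (steps P n) = p"
proof (induction n)
  case 0 show ?case by (simp add: bind_return_pmf')
next
  case (Suc n)
  have "steps P (Suc n) = (\<lambda>x. bind_pmf (steps P n x) P)" by (rule ext) simp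
  hence "bind_pmf p (steps P (Suc n)) = bind_pmf (bind_pmf p (steps P n)) P"
    by (simp only: bind_assoc_pmf)
  thus ?case using Suc assms by (simp del: steps.simps)
qed

text \<open>
Some averages of the steps of an irreducible chain have positive entries even if no single power
of the matrix does. Let \<open>R\<close> be the average of \<open>P\<^sup>i\<close> over \<open>i < K\<close>, where all states are reached from
each other in fewer than \<open>K\<close> steps. If \<open>h\<close> solves the equation for \<open>R\<close>, then the average \<open>g\<close> over
\<open>i < K\<close> of \<open>\<Sum>l<i. P\<^sup>l h\<close> solves it for \<open>P\<close>, since \<open>(I - P) (\<Sum>l<i. P\<^sup>l) = I - P\<^sup>i\<close>.
\<close>

lemma poisson_equation:
  fixes v :: "real \<Rightarrow> real"
  assumes S: "finite S" "S \<noteq> {}"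
    and P: "transition_matrix S P" "irreducible_chain S P"
    and p: "stationary_distribution S P p"
    and v: "measure_pmf.expectation p v = 0"
  obtains g where "\<And>x. x \<in> S \<Longrightarrow> g x - measure_pmf.expectation (P x) g = v x"
proof -
  obtain n where n: "pmf (steps P (n x y) x) y > 0" if "x \<in> S" "y \<in> S" for x y
    using P(2) unfolding irreducible_chain_def by metis
  define K where "K = Suc (Max ((\<lambda>(x, y). n x y) ` (S \<times> S)))"
  have nK: "n x y < K" if "x \<in> S" "y \<in> S" for x y
    unfolding K_def less_Suc_eq_le using that S by (intro Max_ge) auto
  have K0: "K > 0" by (simp add: K_def)
  define R where "R x = bind_pmf (pmf_of_set {..<K}) (\<lambda>i. steps P i x)" for x
  have pmfR: "pmf (R x) y = (\<Sum>i<K. pmf (steps P i x) y) / K" for x y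
    unfolding R_def using K0 by (subst pmf_bind_pmf_of_set) auto
  have stS: "set_pmf (steps P i x) \<subseteq> S" if "x \<in> S" for x i
    using set_steps_subset[OF P(1) that] .
  have finst: "finite (set_pmf (steps P i x))" if "x \<in> S" for x i
    using stS[OF that] S by (meson finite_subset)
  have RS: "set_pmf (R x) \<subseteq> S" if "x \<in> S" for x
    unfolding R_def using stS[OF that] by auto
  have ER: "measure_pmf.expectation (R x) h = (\<Sum>i<K. measure_pmf.expectation (steps P i x) h) / K"
    if "x \<in> S" for x and h :: "real \<Rightarrow> real"
    unfolding R_def using K0 finst[OF that]
    by (subst pmf_expectation_bind_pmf_of_set) (auto simp: divide_inverse_commute sum_distrib_left)
  define \<epsilon> where "\<epsilon> = Min ((\<lambda>(x, y). pmf (R x) y) ` (S \<times> S))"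
  have "pmf (R x) y > 0" if "x \<in> S" "y \<in> S" for x y
    unfolding pmfR using n[OF that] nK[OF that] K0
    by (intro divide_pos_pos sum_pos2[of _ "n x y"]) auto
  hence eps0: "\<epsilon> > 0" unfolding \<epsilon>_def using S by (subst Min_gr_iff) auto
  have eps: "\<epsilon> \<le> pmf (R x) y" if "x \<in> S" "y \<in> S" for x y
    unfolding \<epsilon>_def using that S by (intro Min_le) auto
  have pS: "set_pmf p \<subseteq> S" and pP: "bind_pmf p P = p"
    using p by (auto simp: stationary_distribution_def)
  have "bind_pmf p R = bind_pmf (pmf_of_set {..<K}) (\<lambda>i. bind_pmf p (steps P i))"
    unfolding R_def by (rule bind_commute_pmf)
  hence pR: "bind_pmf p R = p" by (simp add: bind_steps_stationary[OF pP])
  obtain h where h: "\<And>x. x \<in> S \<Longrightarrow> h x - measure_pmf.expectation (R x) h = v x"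
    using poisson_equation_positive_kernel[OF S RS eps eps0 pS pR v] by blast
  define A where "A l x = measure_pmf.expectation (steps P l x) h" for l x
  define g where "g x = (\<Sum>i<K. \<Sum>l<i. A l x) / K" for x
  have PS: "set_pmf (P x) \<subseteq> S" if "x \<in> S" for x
    using P(1) that by (auto simp: transition_matrix_def)
  have finP: "finite (set_pmf (P x))" if "x \<in> S" for x
    using PS[OF that] S by (meson finite_subset)
  have A_step: "measure_pmf.expectation (P x) (A l) = A (Suc l) x" if "x \<in> S" for l x
    unfolding A_def steps_Suc_front
    using PS[OF that] finst by (subst expectation_bind_finite[OF finP[OF that]]) auto
  have "g x - measure_pmf.expectation (P x) g = v x" if x: "x \<in> S" for x
  proof -
    have "measure_pmf.expectation (P x) g = (\<Sum>i<K. \<Sum>l<i. A (Suc l) x) / K"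
      unfolding g_def using finP[OF x]
      by (simp add: integrable_measure_pmf_finite A_step[OF x])
    hence "g x - measure_pmf.expectation (P x) g = (\<Sum>i<K. \<Sum>l<i. A l x - A (Suc l) x) / K"
      by (simp add: g_def diff_divide_distrib sum_subtractf)
    also have "(\<Sum>i<K. \<Sum>l<i. A l x - A (Suc l) x) = (\<Sum>i<K. h x - A i x)"
      by (intro sum.cong refl, subst sum_lessThan_telescope') (simp add: A_def)
    also have "\<dots> / K = h x - measure_pmf.expectation (R x) h"
      using K0 by (simp add: ER[OF x] A_def sum_subtractf diff_divide_distrib)
    finally show ?thesis using h[OF x] by simp
  qed
  thus ?thesis by (rule that)
qed

section \<open>One arm: the compensated reward\<close>

text \<open>
In what follows \<open>p\<close> is the past of one arm: its states, flagged by whether the arm was played.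
\<close>

definition active :: "(real \<times> bool) list \<Rightarrow> bool" where
  "active p \<longleftrightarrow> p \<noteq> [] \<and> snd (last p)"

definition plays :: "(real \<times> bool) list \<Rightarrow> nat" where
  "plays p = length (filter snd p)"

definition collected :: "(real \<times> bool) list \<Rightarrow> real" where
  "collected p = sum_list (map fst (filter snd p))"

text \<open>
For a solution \<open>g\<close> of the Poisson equation, \<open>g x - (x - m)\<close> is the expectation of \<open>g\<close> at the
successor of \<open>x\<close>. So this is the expected value of \<open>g\<close> at the state that the arm is about to reach
from a play, the half of a martingale difference that is still waiting for its other half.
\<close>

definition pending :: "real \<Rightarrow> (real \<Rightarrow> real) \<Rightarrow> (real \<times> bool) list \<Rightarrow> real" where
  "pending m g p = (if active p then g (fst (last p)) - (fst (last p) - m) else 0)"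

text \<open>
Replacing \<open>x - m\<close> by \<open>g x\<close> minus the expected next value of \<open>g\<close> turns the centred reward of a run of
consecutive plays into a martingale, up to one boundary term at either end of the run. The
compensated reward is the process that has these martingale differences as increments.
\<close>

definition compensated :: "real \<Rightarrow> (real \<Rightarrow> real) \<Rightarrow> (real \<times> bool) list \<Rightarrow> real" where
  "compensated m g p = collected p - m * plays p + pending m g p"

lemma plays_snoc [simp]: "plays (p @ [(y, b)]) = plays p + of_bool b"
  by (simp add: plays_def)

lemma compensated_Nil [simp]: "compensated m g [] = 0"
  by (simp add: compensated_def collected_def plays_def pending_def active_def)

lemma compensated_snoc:
  "compensated m g (p @ [(y, b)]) = compensated m g p + (of_bool b * g y - pending m g p)"
  by (simp add: compensated_def collected_def plays_def pending_def active_def algebra_simps)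

text \<open>
Hoeffding's lemma for both signs of the exponent.
\<close>

lemma expectation_exp_centered:
  fixes X :: "'a \<Rightarrow> real"
  assumes fin: "finite (set_pmf p)" and bnd: "\<And>x. x \<in> set_pmf p \<Longrightarrow> \<bar>X x\<bar> \<le> c"
    and mean: "measure_pmf.expectation p X = 0"
  shows "measure_pmf.expectation p (\<lambda>x. exp (l * X x)) \<le> exp (l\<^sup>2 * c\<^sup>2 / 2)"
proof -
  have pos: "measure_pmf.expectation p (\<lambda>x. exp (k * Y x)) \<le> exp (k\<^sup>2 * c\<^sup>2 / 2)"
    if "k > 0" "\<And>x. x \<in> set_pmf p \<Longrightarrow> \<bar>Y x\<bar> \<le> c" "measure_pmf.expectation p Y = 0" for k Y
  proof -
    interpret prob_space "measure_pmf p" by (rule measure_pmf.prob_space_axioms)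
    interpret interval_bounded_random_variable "measure_pmf p" Y "- c" c
      by unfold_locales (use that(2) in \<open>simp_all add: AE_measure_pmf_iff abs_le_iff minus_le_iff\<close>)
    have "nn_integral p (\<lambda>x. exp (k * Y x)) \<le> ennreal (exp (k\<^sup>2 * (c - - c)\<^sup>2 / 8))"
      using Hoeffdings_lemma_nn_integral_0[OF that(1) that(3)] .
    moreover have "nn_integral p (\<lambda>x. exp (k * Y x)) = ennreal (measure_pmf.expectation p (\<lambda>x. exp (k * Y x)))"
      by (intro nn_integral_eq_integral integrable_measure_pmf_finite fin) auto
    ultimately have "measure_pmf.expectation p (\<lambda>x. exp (k * Y x)) \<le> exp (k\<^sup>2 * (c - - c)\<^sup>2 / 8)"
      by simp
    thus ?thesis by (simp add: power2_eq_square algebra_simps)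
  qed
  consider "l > 0" | "l = 0" | "l < 0" by linarith
  thus ?thesis
  proof cases
    case 1 thus ?thesis using pos[of l X] bnd mean by simp
  next
    case 2 thus ?thesis by simp
  next
    case 3 thus ?thesis using pos[of "- l" "\<lambda>x. - X x"] bnd mean by simp
  qed
qed

lemma set_arm_next_subset:
  assumes "transition_matrix S P" "set_pmf \<iota> \<subseteq> S" "set_pmf (Q p) \<subseteq> S" "fst ` set p \<subseteq> S"
  shows "set_pmf (arm_next \<iota> P Q p) \<subseteq> S"
proof -
  have "fst (last p) \<in> S" if "p \<noteq> []" using assms(4) that by auto
  thus ?thesis using assms by (simp add: arm_next_def transition_matrix_def)
qed

text \<open>
One more step of an arm, with \<open>b\<close> telling whether it is played. If it is played twice in a row, then
the increment of the compensated reward is centred; if it stays passive, then the increment is zero.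
Only a switch between the two modes causes a drift, because a passive arm may move to any state
whatever, and the drift is at most the size \<open>G\<close> of the solution of the Poisson equation.
\<close>

lemma
  fixes g :: "real \<Rightarrow> real"
  assumes S: "finite S" and P: "transition_matrix S P"
    and iota: "set_pmf \<iota> \<subseteq> S" and Q: "set_pmf (Q p) \<subseteq> S"
    and poisson: "\<And>x. x \<in> S \<Longrightarrow> g x - measure_pmf.expectation (P x) g = x - m"
    and G: "\<And>x. x \<in> S \<Longrightarrow> \<bar>g x\<bar> \<le> G" "0 \<le> G"
    and p: "fst ` set p \<subseteq> S"
  shows abs_pending_le: "\<bar>pending m g p\<bar> \<le> G"
    and compensated_drift:
      "\<bar>measure_pmf.expectation (arm_next \<iota> P Q p) (\<lambda>y. compensated m g (p @ [(y, b)]))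
          - compensated m g p\<bar> \<le> G * of_bool (b \<noteq> active p)"
    and compensated_exp_step:
      "measure_pmf.expectation (arm_next \<iota> P Q p)
          (\<lambda>y. exp (l * (compensated m g (p @ [(y, b)]) - compensated m g p)))
        \<le> exp (2 * l\<^sup>2 * G\<^sup>2 * of_bool b + \<bar>l\<bar> * G * of_bool (b \<noteq> active p))"
proof -
  let ?q = "arm_next \<iota> P Q p"
  have lastS: "fst (last p) \<in> S" if "p \<noteq> []" using p that by auto
  have qS: "set_pmf ?q \<subseteq> S" by (rule set_arm_next_subset[where Q = Q and p = p]) fact+
  have fin: "finite (set_pmf ?q)" using qS S by (rule finite_subset)
  have gq: "\<bar>g y\<bar> \<le> G" if "y \<in> set_pmf ?q" for y using G qS that by auto
  have pend: "pending m g p = measure_pmf.expectation ?q g" if "active p"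
    using that poisson[OF lastS] by (auto simp: pending_def arm_next_def active_def)
  show pend_le: "\<bar>pending m g p\<bar> \<le> G"
  proof (cases "active p")
    case True
    show ?thesis unfolding pend[OF True] by (rule abs_expectation_le_finite[OF fin gq])
  qed (simp add: pending_def G)
  have pend0: "pending m g p = 0" if "\<not> active p" using that by (simp add: pending_def)
  have "measure_pmf.expectation ?q (\<lambda>y. compensated m g (p @ [(y, b)])) - compensated m g p
      = of_bool b * measure_pmf.expectation ?q g - pending m g p"
    unfolding compensated_snoc by (simp add: integrable_measure_pmf_finite[OF fin])
  thus "\<bar>measure_pmf.expectation ?q (\<lambda>y. compensated m g (p @ [(y, b)]))
          - compensated m g p\<bar> \<le> G * of_bool (b \<noteq> active p)"
    using pend_le pend pend0 abs_expectation_le_finite[OF fin gq] by (cases b; cases "active p") auto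
  have le: "l * x \<le> \<bar>l\<bar> * G" if "\<bar>x\<bar> \<le> G" for x
    using mult_left_mono[OF that, of "\<bar>l\<bar>"] abs_ge_self[of "l * x"] by (simp add: abs_mult)
  have "measure_pmf.expectation ?q (\<lambda>y. exp (l * (of_bool b * g y - pending m g p)))
      \<le> exp (2 * l\<^sup>2 * G\<^sup>2 * of_bool b + \<bar>l\<bar> * G * of_bool (b \<noteq> active p))"
  proof (cases "b \<and> active p")
    case True
    have "measure_pmf.expectation ?q (\<lambda>y. exp (l * (g y - pending m g p))) \<le> exp (l\<^sup>2 * (2 * G)\<^sup>2 / 2)"
    proof (rule expectation_exp_centered[OF fin])
      show "\<bar>g y - pending m g p\<bar> \<le> 2 * G" if "y \<in> set_pmf ?q" for y
        using gq[OF that] pend_le by linarith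
      show "measure_pmf.expectation ?q (\<lambda>y. g y - pending m g p) = 0"
        using pend True by (simp add: integrable_measure_pmf_finite[OF fin])
    qed
    thus ?thesis using True by (simp add: power_mult_distrib mult_ac)
  next
    case False
    show ?thesis
    proof (rule expectation_le_const_finite[OF fin])
      fix y assume y: "y \<in> set_pmf ?q"
      have "l * (of_bool b * g y - pending m g p) \<le> \<bar>l\<bar> * G * of_bool (b \<noteq> active p)"
        using False le[OF gq[OF y]] le[of "- pending m g p"] pend_le pend0
        by (cases b; cases "active p") auto
      moreover have "0 \<le> 2 * l\<^sup>2 * G\<^sup>2 * of_bool b" by simp
      ultimately show "exp (l * (of_bool b * g y - pending m g p))
          \<le> exp (2 * l\<^sup>2 * G\<^sup>2 * of_bool b + \<bar>l\<bar> * G * of_bool (b \<noteq> active p))"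
        unfolding exp_le_cancel_iff by linarith
    qed
  qed
  thus "measure_pmf.expectation ?q
          (\<lambda>y. exp (l * (compensated m g (p @ [(y, b)]) - compensated m g p)))
        \<le> exp (2 * l\<^sup>2 * G\<^sup>2 * of_bool b + \<bar>l\<bar> * G * of_bool (b \<noteq> active p))"
    unfolding compensated_snoc by simp
qed

section \<open>Histories of the bandit\<close>

lemma arm_past_snoc [simp]: "arm_past j (h @ [(x, A)]) = arm_past j h @ [(x j, j \<in> A)]"
  by (simp add: arm_past_def)

lemma arm_past_Nil [simp]: "arm_past j [] = []"
  by (simp add: arm_past_def)

lemma rewards_observations: "rewards j (observations h) = map fst (filter snd (arm_past j h))"
  by (induction h) (auto simp: rewards_def observations_def arm_past_def restrict_map_def List.map_filter_simps)

lemma observations_take: "observations (take n h) = take n (observations h)"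
  by (simp add: observations_def take_map)

lemma sample_mean_observations:
  "sample_mean j (observations h) = collected (arm_past j h) / plays (arm_past j h)"
  by (simp add: sample_mean_def rewards_observations collected_def plays_def)

lemma total_reward_eq_collected: "total_reward N h = (\<Sum>j=1..N. collected (arm_past j h))"
  by (simp add: total_reward_def rewards_observations collected_def)

text \<open>
What is decided at the start of an epoch depends on a prefix of the history only; this consistency
of the laws lets its probability be computed at that earlier time.
\<close>

lemma map_take_bandit_law:
  "n \<le> t \<Longrightarrow> map_pmf (take n) (bandit_law N \<iota> P Q \<phi> t) = bandit_law N \<iota> P Q \<phi> n"
proof -
  have len: "length h = t" if "h \<in> set_pmf (bandit_law N \<iota> P Q \<phi> t)" for h t
    using that by (induction t arbitrary: h) auto
  show "n \<le> t \<Longrightarrow> map_pmf (take n) (bandit_law N \<iota> P Q \<phi> t) = bandit_law N \<iota> P Q \<phi> n"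
  proof (induction t)
    case (Suc t)
    show ?case
    proof (cases "n = Suc t")
      case True
      have "map_pmf (take n) (bandit_law N \<iota> P Q \<phi> (Suc t)) = map_pmf id (bandit_law N \<iota> P Q \<phi> (Suc t))"
        using True by (intro map_pmf_cong refl) (auto dest!: len)
      thus ?thesis using True by (simp only: map_pmf_id id_apply)
    next
      case False
      hence n: "n \<le> t" using Suc.prems by simp
      have "map_pmf (take n) (bandit_law N \<iota> P Q \<phi> (Suc t))
          = bind_pmf (bandit_law N \<iota> P Q \<phi> t) (\<lambda>h. return_pmf (take n h))"
        unfolding bandit_law.simps map_bind_pmf pmf.map_comp
      proof (intro bind_pmf_cong refl)
        fix h assume "h \<in> set_pmf (bandit_law N \<iota> P Q \<phi> t)"
        hence "take n \<circ> (\<lambda>x. h @ [(x, \<phi> (observations h))]) = (\<lambda>_. take n h)"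
          using n by (auto simp: fun_eq_iff dest!: len)
        thus "map_pmf (take n \<circ> (\<lambda>x. h @ [(x, \<phi> (observations h))]))
            (Pi_pmf {1..N} 0 (\<lambda>j. arm_next (\<iota> j) (P j) (Q j) (arm_past j h))) = return_pmf (take n h)"
          by (simp add: map_pmf_const)
      qed
      also have "\<dots> = bandit_law N \<iota> P Q \<phi> n" using Suc.IH[OF n] by (simp add: map_pmf_def)
      finally show ?thesis .
    qed
  qed simp
qed

locale restless_arms =
  fixes N :: nat and S :: "nat \<Rightarrow> real set" and P :: "nat \<Rightarrow> real \<Rightarrow> real pmf"
    and \<iota> :: "nat \<Rightarrow> real pmf" and Q :: "nat \<Rightarrow> (real \<times> bool) list \<Rightarrow> real pmf"
  assumes finite_states: "j \<in> {1..N} \<Longrightarrow> finite (S j)"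
    and transition: "j \<in> {1..N} \<Longrightarrow> transition_matrix (S j) (P j)"
    and initial_states: "j \<in> {1..N} \<Longrightarrow> set_pmf (\<iota> j) \<subseteq> S j"
    and passive_states: "j \<in> {1..N} \<Longrightarrow> set_pmf (Q j p) \<subseteq> S j"
begin

abbreviation law :: "policy \<Rightarrow> nat \<Rightarrow> history pmf" where
  "law \<phi> t \<equiv> bandit_law N \<iota> P Q \<phi> t"

abbreviation next_law :: "nat \<Rightarrow> (real \<times> bool) list \<Rightarrow> real pmf" where
  "next_law j p \<equiv> arm_next (\<iota> j) (P j) (Q j) p"

lemma set_next_law:
  assumes "j \<in> {1..N}" "fst ` set p \<subseteq> S j"
  shows "set_pmf (next_law j p) \<subseteq> S j"
  using assms(2)
  by (intro set_arm_next_subset transition[OF assms(1)] initial_states[OF assms(1)]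
      passive_states[OF assms(1)])

lemma law_history:
  assumes "h \<in> set_pmf (law \<phi> t)"
  shows "length h = t" and "j \<in> {1..N} \<Longrightarrow> fst ` set (arm_past j h) \<subseteq> S j"
    and "i < t \<Longrightarrow> snd (h ! i) = \<phi> (take i (observations h))"
proof -
  have "length h = t \<and> (\<forall>j\<in>{1..N}. fst ` set (arm_past j h) \<subseteq> S j)
      \<and> (\<forall>i<t. snd (h ! i) = \<phi> (take i (observations h)))"
    using assms
  proof (induction t arbitrary: h)
    case (Suc t)
    then obtain h' x where h': "h' \<in> set_pmf (law \<phi> t)" and h: "h = h' @ [(x, \<phi> (observations h'))]"
      and x: "x \<in> set_pmf (Pi_pmf {1..N} 0 (\<lambda>j. next_law j (arm_past j h')))"
      by auto
    have IH: "length h' = t" "\<And>j. j \<in> {1..N} \<Longrightarrow> fst ` set (arm_past j h') \<subseteq> S j"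
      "\<And>i. i < t \<Longrightarrow> snd (h' ! i) = \<phi> (take i (observations h'))"
      using Suc.IH[OF h'] by auto
    have "x j \<in> S j" if j: "j \<in> {1..N}" for j
    proof -
      have "x j \<in> set_pmf (next_law j (arm_past j h'))"
        using x j by (auto simp: set_Pi_pmf PiE_dflt_def)
      thus ?thesis using set_next_law[OF j IH(2)[OF j]] by auto
    qed
    moreover have "snd (h ! i) = \<phi> (take i (observations h))" if "i < Suc t" for i
      using that IH(1,3) by (auto simp: h nth_append observations_def less_Suc_eq)
    ultimately show ?case using IH(1,2) by (auto simp: h)
  qed simp
  thus "length h = t" "j \<in> {1..N} \<Longrightarrow> fst ` set (arm_past j h) \<subseteq> S j"
    "i < t \<Longrightarrow> snd (h ! i) = \<phi> (take i (observations h))" by auto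
qed

lemma finite_product_law:
  assumes "h \<in> set_pmf (law \<phi> t)"
  shows "finite (set_pmf (Pi_pmf {1..N} 0 (\<lambda>j. next_law j (arm_past j h))))"
proof -
  have "finite (set_pmf (next_law j (arm_past j h)))" if "j \<in> {1..N}" for j
    using set_next_law[OF that law_history(2)[OF assms that]] finite_states[OF that]
    by (rule finite_subset)
  thus ?thesis by (auto simp: set_Pi_pmf intro!: finite_PiE_dflt)
qed

lemma finite_law: "finite (set_pmf (law \<phi> t))"
  by (induction t) (auto intro!: finite_imageI finite_product_law[simplified])

text \<open>
For one arm the product law of the next state vector can be replaced by its marginal. The other arms
enter only through the decision of the policy, which is determined by the history.
\<close>

lemma expectation_law_Suc:
  assumes j: "j \<in> {1..N}"
  shows "measure_pmf.expectation (law \<phi> (Suc t)) (\<lambda>h. F (arm_past j h))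
    = measure_pmf.expectation (law \<phi> t) (\<lambda>h. measure_pmf.expectation (next_law j (arm_past j h))
        (\<lambda>y. F (arm_past j h @ [(y, j \<in> \<phi> (observations h))]) :: real))"
proof -
  have "measure_pmf.expectation (law \<phi> (Suc t)) (\<lambda>h. F (arm_past j h))
     = measure_pmf.expectation (law \<phi> t) (\<lambda>h.
        measure_pmf.expectation (Pi_pmf {1..N} 0 (\<lambda>j. next_law j (arm_past j h)))
        (\<lambda>x. F (arm_past j h @ [(x j, j \<in> \<phi> (observations h))])))"
    unfolding bandit_law.simps
    by (subst expectation_bind_finite[OF finite_law]) (auto intro!: finite_imageI finite_product_law[simplified])
  also have "\<dots> = measure_pmf.expectation (law \<phi> t) (\<lambda>h.
        measure_pmf.expectation (map_pmf (\<lambda>x. x j) (Pi_pmf {1..N} 0 (\<lambda>j. next_law j (arm_past j h))))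
        (\<lambda>y. F (arm_past j h @ [(y, j \<in> \<phi> (observations h))])))"
    by simp
  also have "\<dots> = measure_pmf.expectation (law \<phi> t) (\<lambda>h. measure_pmf.expectation (next_law j (arm_past j h))
        (\<lambda>y. F (arm_past j h @ [(y, j \<in> \<phi> (observations h))])))"
    using j by (subst Pi_pmf_component) auto
  finally show ?thesis .
qed

end

text \<open>
The switches of the arm between playing and passivity occur at times of a deterministic set \<open>W\<close>. This
is what makes the accumulated drift a deterministic quantity, however random the set of played arms.
\<close>

locale poisson_arm = restless_arms +
  fixes j :: nat and g :: "real \<Rightarrow> real" and m G :: real and \<phi> :: policy and W :: "nat set"
  assumes arm: "j \<in> {1..N}"
    and poisson: "x \<in> S j \<Longrightarrow> g x - measure_pmf.expectation (P j x) g = x - m"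
    and G: "x \<in> S j \<Longrightarrow> \<bar>g x\<bar> \<le> G" "0 \<le> G"
    and switches: "h \<in> set_pmf (law \<phi> t) \<Longrightarrow> (j \<in> \<phi> (observations h)) \<noteq> active (arm_past j h)
      \<Longrightarrow> Suc t \<in> W"
begin

definition switch_count :: "nat \<Rightarrow> nat" where
  "switch_count t = card (W \<inter> {1..t})"

lemma switch_count_Suc: "switch_count (Suc t) = switch_count t + of_bool (Suc t \<in> W)"
proof -
  have "W \<inter> {1..Suc t} = (if Suc t \<in> W then insert (Suc t) (W \<inter> {1..t}) else W \<inter> {1..t})"
    by (auto simp: le_Suc_eq)
  thus ?thesis by (simp add: switch_count_def)
qed

abbreviation Z :: "history \<Rightarrow> real" where "Z h \<equiv> compensated m g (arm_past j h)"

lemmas step_assms = finite_states[OF arm] transition[OF arm] initial_states[OF arm]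
  passive_states[OF arm] poisson G

lemma abs_pending_law:
  assumes "h \<in> set_pmf (law \<phi> t)"
  shows "\<bar>pending m g (arm_past j h)\<bar> \<le> G"
  using abs_pending_le[OF step_assms law_history(2)[OF assms arm]] .

lemma abs_expectation_compensated:
  "\<bar>measure_pmf.expectation (law \<phi> t) Z\<bar> \<le> G * switch_count t"
proof (induction t)
  case 0 show ?case by (simp add: switch_count_def)
next
  case (Suc t)
  let ?E = "measure_pmf.expectation"
  let ?Z' = "\<lambda>h. ?E (next_law j (arm_past j h))
      (\<lambda>y. compensated m g (arm_past j h @ [(y, j \<in> \<phi> (observations h))]))"
  have "?E (law \<phi> (Suc t)) Z = ?E (law \<phi> t) ?Z'"
    by (rule expectation_law_Suc[OF arm])
  hence "?E (law \<phi> (Suc t)) Z - ?E (law \<phi> t) Z = ?E (law \<phi> t) (\<lambda>h. ?Z' h - Z h)"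
    by (simp add: integrable_measure_pmf_finite[OF finite_law])
  moreover have "\<bar>?E (law \<phi> t) (\<lambda>h. ?Z' h - Z h)\<bar> \<le> G * of_bool (Suc t \<in> W)"
  proof (rule abs_expectation_le_finite[OF finite_law])
    fix h assume h: "h \<in> set_pmf (law \<phi> t)"
    have "\<bar>?Z' h - Z h\<bar> \<le> G * of_bool ((j \<in> \<phi> (observations h)) \<noteq> active (arm_past j h))"
      by (rule compensated_drift[OF step_assms law_history(2)[OF h arm]])
    also have "\<dots> \<le> G * of_bool (Suc t \<in> W)"
      using switches[OF h] G(2) by (intro mult_left_mono) auto
    finally show "\<bar>?Z' h - Z h\<bar> \<le> G * of_bool (Suc t \<in> W)" .
  qed
  ultimately have "\<bar>?E (law \<phi> (Suc t)) Z\<bar> \<le> G * switch_count t + G * of_bool (Suc t \<in> W)"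
    using Suc by linarith
  thus ?case by (simp add: switch_count_Suc algebra_simps)
qed

text \<open>
The variance is charged to the number of plays, not to the elapsed time, so that one estimate covers
all values of this random number.
\<close>

lemma exponential_supermartingale:
  "measure_pmf.expectation (law \<phi> t) (\<lambda>h. exp (l * Z h - 2 * l\<^sup>2 * G\<^sup>2 * plays (arm_past j h)
      - \<bar>l\<bar> * G * switch_count t)) \<le> 1"
proof (induction t)
  case 0 show ?case by (simp add: switch_count_def plays_def)
next
  case (Suc t)
  let ?E = "measure_pmf.expectation"
  define Y where "Y t p = exp (l * compensated m g p - 2 * l\<^sup>2 * G\<^sup>2 * plays p - \<bar>l\<bar> * G * switch_count t)" for t p
  have "?E (law \<phi> (Suc t)) (\<lambda>h. Y (Suc t) (arm_past j h))
    = ?E (law \<phi> t) (\<lambda>h. ?E (next_law j (arm_past j h))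
        (\<lambda>y. Y (Suc t) (arm_past j h @ [(y, j \<in> \<phi> (observations h))])))"
    by (rule expectation_law_Suc[OF arm])
  also have "\<dots> \<le> ?E (law \<phi> t) (\<lambda>h. Y t (arm_past j h))"
  proof (rule expectation_mono_finite[OF finite_law])
    fix h assume h: "h \<in> set_pmf (law \<phi> t)"
    let ?p = "arm_past j h" and ?b = "j \<in> \<phi> (observations h)"
    let ?c = "2 * l\<^sup>2 * G\<^sup>2 * of_bool ?b + \<bar>l\<bar> * G * of_bool (Suc t \<in> W)"
    have "Y (Suc t) (?p @ [(y, ?b)])
        = Y t ?p * exp (- ?c) * exp (l * (compensated m g (?p @ [(y, ?b)]) - compensated m g ?p))" for y
      by (simp add: Y_def switch_count_Suc exp_add[symmetric] algebra_simps del: of_bool_eq_iff)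
    hence "?E (next_law j ?p) (\<lambda>y. Y (Suc t) (?p @ [(y, ?b)]))
      = Y t ?p * exp (- ?c) * ?E (next_law j ?p)
          (\<lambda>y. exp (l * (compensated m g (?p @ [(y, ?b)]) - compensated m g ?p)))"
      by simp
    also have "\<dots> \<le> Y t ?p * exp (- ?c) * exp ?c"
    proof (rule mult_left_mono)
      have "?E (next_law j ?p) (\<lambda>y. exp (l * (compensated m g (?p @ [(y, ?b)]) - compensated m g ?p)))
        \<le> exp (2 * l\<^sup>2 * G\<^sup>2 * of_bool ?b + \<bar>l\<bar> * G * of_bool (?b \<noteq> active ?p))"
        by (rule compensated_exp_step[OF step_assms law_history(2)[OF h arm]])
      also have "\<dots> \<le> exp ?c"
        using switches[OF h] G(2)
        by (subst exp_le_cancel_iff, intro add_left_mono mult_left_mono) auto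
      finally show "?E (next_law j ?p) (\<lambda>y. exp (l * (compensated m g (?p @ [(y, ?b)]) - compensated m g ?p)))
        \<le> exp ?c" .
    qed (simp add: Y_def)
    also have "\<dots> = Y t ?p" by (simp only: mult.assoc exp_add[symmetric]) simp
    finally show "?E (next_law j ?p) (\<lambda>y. Y (Suc t) (?p @ [(y, ?b)])) \<le> Y t ?p" .
  qed
  also have "\<dots> \<le> 1" using Suc by (simp add: Y_def)
  finally show ?case by (simp add: Y_def)
qed

text \<open>
Markov's inequality for the exponential supermartingale; \<open>e\<close> is the sign of the deviation. Of the
deviation \<open>\<delta> * n\<close> after \<open>n \<ge> X\<close> plays, one half pays for the variance, a quarter for the boundary
terms of the switches, and the rest gives the exponent.
\<close>

lemma one_sided_deviation:
  assumes d: "\<delta> > 0" and G0: "G > 0" and e: "\<bar>e\<bar> = 1"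
    and small: "G * (1 + switch_count t) \<le> \<delta> * X / 4"
  shows "measure_pmf.prob (law \<phi> t) {h. real (plays (arm_past j h)) \<ge> X \<and>
      e * (collected (arm_past j h) - m * plays (arm_past j h)) > \<delta> * plays (arm_past j h)}
    \<le> exp (- (\<delta>\<^sup>2 * X / (16 * G\<^sup>2)))" (is "measure_pmf.prob _ ?A \<le> _")
proof -
  let ?E = "measure_pmf.expectation"
  \<comment> \<open>The variance term \<open>2 * l\<^sup>2 * G\<^sup>2 * n\<close> then equals one half of \<open>l * \<delta> * n\<close>.\<close>
  define l where "l = \<delta> / (4 * G\<^sup>2)"
  have l0: "l > 0" using d G0 by (simp add: l_def)
  define Y where "Y h = exp (e * l * Z h - 2 * (e * l)\<^sup>2 * G\<^sup>2 * plays (arm_past j h)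
      - \<bar>e * l\<bar> * G * switch_count t)" for h
  have el: "\<bar>e * l\<bar> = l" "(e * l)\<^sup>2 = l\<^sup>2"
    using e l0 by (simp_all add: abs_mult power_mult_distrib abs_square_eq_1)
  have "measure_pmf.prob (law \<phi> t) ?A = ?E (law \<phi> t) (indicator ?A)"
    by simp
  also have "\<dots> \<le> ?E (law \<phi> t) (\<lambda>h. exp (- (\<delta>\<^sup>2 * X / (16 * G\<^sup>2))) * Y h)"
  proof (rule expectation_mono_finite[OF finite_law])
    fix h assume h: "h \<in> set_pmf (law \<phi> t)"
    show "indicator ?A h \<le> exp (- (\<delta>\<^sup>2 * X / (16 * G\<^sup>2))) * Y h"
    proof (cases "h \<in> ?A")
      case True
      let ?n = "real (plays (arm_past j h))"
      have n: "?n \<ge> X" and dev: "e * (collected (arm_past j h) - m * ?n) > \<delta> * ?n"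
        using True by auto
      have "\<bar>e * pending m g (arm_past j h)\<bar> \<le> G"
        using abs_pending_law[OF h] e by (simp add: abs_mult)
      hence "e * Z h \<ge> \<delta> * ?n - G"
        using dev by (simp add: compensated_def algebra_simps abs_le_iff)
      hence "l * (e * Z h) \<ge> l * (\<delta> * ?n - G)" using l0 by simp
      moreover have "2 * l\<^sup>2 * G\<^sup>2 = l * \<delta> / 2"
        using G0 by (simp add: l_def power2_eq_square)
      hence "2 * l\<^sup>2 * G\<^sup>2 * ?n = l * (\<delta> * ?n / 2)" by simp
      moreover have "e * l * Z h = l * (e * Z h)" "l * G * switch_count t = l * (G * switch_count t)"
        by simp_all
      moreover have "l * (\<delta> * ?n - G) - l * (\<delta> * ?n / 2) - l * (G * switch_count t)
          = l * (\<delta> * ?n / 2 - G * (1 + switch_count t))"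
        by (simp add: algebra_simps)
      ultimately have "e * l * Z h - 2 * (e * l)\<^sup>2 * G\<^sup>2 * ?n - \<bar>e * l\<bar> * G * switch_count t
          \<ge> l * (\<delta> * ?n / 2 - G * (1 + switch_count t))"
        unfolding el by linarith
      moreover have "\<delta> * ?n / 2 - G * (1 + switch_count t) \<ge> \<delta> * X / 4"
        using mult_left_mono[OF n, of \<delta>] small d by linarith
      hence "l * (\<delta> * ?n / 2 - G * (1 + switch_count t)) \<ge> l * (\<delta> * X / 4)"
        using l0 by simp
      moreover have "l * (\<delta> * X / 4) = \<delta>\<^sup>2 * X / (16 * G\<^sup>2)"
        by (simp add: l_def power2_eq_square)
      ultimately have "exp (\<delta>\<^sup>2 * X / (16 * G\<^sup>2)) \<le> Y h"
        unfolding Y_def exp_le_cancel_iff by linarith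
      hence "exp (- (\<delta>\<^sup>2 * X / (16 * G\<^sup>2))) * exp (\<delta>\<^sup>2 * X / (16 * G\<^sup>2))
          \<le> exp (- (\<delta>\<^sup>2 * X / (16 * G\<^sup>2))) * Y h" by (intro mult_left_mono) auto
      thus ?thesis using True by (simp add: exp_minus)
    qed (simp add: Y_def)
  qed
  also have "\<dots> = exp (- (\<delta>\<^sup>2 * X / (16 * G\<^sup>2))) * ?E (law \<phi> t) Y" by simp
  also have "\<dots> \<le> exp (- (\<delta>\<^sup>2 * X / (16 * G\<^sup>2))) * 1"
    unfolding Y_def by (intro mult_left_mono exponential_supermartingale) auto
  finally show ?thesis by simp
qed

lemma sample_mean_deviation:
  assumes d: "\<delta> > 0" and G0: "G > 0" and X: "X > 0"
    and small: "G * (1 + switch_count t) \<le> \<delta> * X / 4"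
    and plays: "\<And>h. h \<in> set_pmf (law \<phi> t) \<Longrightarrow> real (plays (arm_past j h)) \<ge> X"
  shows "measure_pmf.prob (law \<phi> t) {h. \<bar>sample_mean j (observations h) - m\<bar> > \<delta>}
    \<le> 2 * exp (- (\<delta>\<^sup>2 * X / (16 * G\<^sup>2)))"
proof -
  define A where "A e = {h. real (plays (arm_past j h)) \<ge> X \<and>
      e * (collected (arm_past j h) - m * plays (arm_past j h)) > \<delta> * plays (arm_past j h)}" for e
  let ?p = "measure_pmf.prob (law \<phi> t)"
  have "?p {h. \<bar>sample_mean j (observations h) - m\<bar> > \<delta>} \<le> ?p (A 1 \<union> A (-1))"
  proof (rule measure_pmf.finite_measure_mono_AE)
    show "AE h in law \<phi> t. h \<in> {h. \<bar>sample_mean j (observations h) - m\<bar> > \<delta>} \<longrightarrow> h \<in> A 1 \<union> A (-1)"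
    proof (intro AE_pmfI impI)
      fix h assume h: "h \<in> set_pmf (law \<phi> t)"
        and dev: "h \<in> {h. \<bar>sample_mean j (observations h) - m\<bar> > \<delta>}"
      let ?n = "real (plays (arm_past j h))" and ?c = "collected (arm_past j h)"
      have n: "?n \<ge> X" using plays[OF h] .
      hence n0: "?n > 0" using X by linarith
      have "?c = sample_mean j (observations h) * ?n"
        using n0 by (simp add: sample_mean_observations)
      hence eq: "?c - m * ?n = (sample_mean j (observations h) - m) * ?n" by (simp add: algebra_simps)
      from dev have "\<delta> < sample_mean j (observations h) - m \<or> \<delta> < - (sample_mean j (observations h) - m)"
        by (auto simp: abs_real_def split: if_splits)
      hence "\<delta> * ?n < ?c - m * ?n \<or> \<delta> * ?n < - (?c - m * ?n)"
        unfolding eq minus_mult_left mult_less_cancel_right_pos[OF n0] .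
      thus "h \<in> A 1 \<union> A (-1)" using n by (auto simp: A_def)
    qed
  qed auto
  also have "\<dots> \<le> ?p (A 1) + ?p (A (-1))"
    by (rule measure_Un_le) auto
  also have "\<dots> \<le> 2 * exp (- (\<delta>\<^sup>2 * X / (16 * G\<^sup>2)))"
    using one_sided_deviation[OF d G0 _ small, of 1] one_sided_deviation[OF d G0 _ small, of "-1"]
    unfolding A_def by simp
  finally show ?thesis .
qed

end

section \<open>The epochs of the DSEE policy\<close>

definition follows :: "policy \<Rightarrow> history \<Rightarrow> bool" where
  "follows \<phi> h \<longleftrightarrow> (\<forall>i<length h. snd (h ! i) = \<phi> (take i (observations h)))"

lemma length_observations [simp]: "length (observations h) = length h"
  by (simp add: observations_def)

lemma active_arm_past: "active (arm_past j h) \<longleftrightarrow> h \<noteq> [] \<and> j \<in> snd (last h)"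
  by (auto simp: active_def arm_past_def last_map split: prod.splits)

lemma plays_arm_past: "plays (arm_past j h) = card {i. i < length h \<and> j \<in> snd (h ! i)}"
proof -
  have "snd (arm_past j h ! i) \<longleftrightarrow> j \<in> snd (h ! i)" if "i < length h" for i
    using that by (simp add: arm_past_def split: prod.splits)
  thus ?thesis
    unfolding plays_def length_filter_conv_card
    by (intro arg_cong[of _ _ card]) (auto simp: arm_past_def)
qed

locale dsee_epochs =
  fixes N M :: nat and D :: "nat \<Rightarrow> real"
    and block :: "nat \<Rightarrow> nat \<Rightarrow> nat" and best :: "observation list \<Rightarrow> nat set"
  assumes M_pos: "0 < M" and N_pos: "0 < N"
    and blocks: "block_assignment N M block"
begin

abbreviation B :: nat where "B \<equiv> num_blocks N M"

definition start :: "nat \<Rightarrow> nat" where "start k = fst (epoch N M D k)"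
definition explorations :: "nat \<Rightarrow> nat" where "explorations k = fst (snd (epoch N M D k))"
definition exploitations :: "nat \<Rightarrow> nat" where "exploitations k = snd (snd (epoch N M D k))"

abbreviation exploiting :: "nat \<Rightarrow> bool" where
  "exploiting k \<equiv> exploits D (start k) (explorations k)"

definition current :: "nat \<Rightarrow> nat" where
  "current t = (LEAST k. t < start (Suc k))"

abbreviation policy :: policy where "policy \<equiv> dsee N M D block best"

lemma B_pos: "0 < B"
  using M_pos N_pos by (simp add: num_blocks_def)

lemma epoch_0 [simp]: "start 0 = 1" "explorations 0 = 0" "exploitations 0 = 0"
  by (simp_all add: start_def explorations_def exploitations_def)

lemma epoch_Suc:
  "start (Suc k) = start k + (if exploiting k then 2 * 4 ^ exploitations k else B * 4 ^ explorations k)"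
  "explorations (Suc k) = (if exploiting k then explorations k else Suc (explorations k))"
  "exploitations (Suc k) = (if exploiting k then Suc (exploitations k) else exploitations k)"
  by (auto simp: start_def explorations_def exploitations_def split: prod.splits)

lemma counter_sum: "explorations k + exploitations k = k"
  by (induction k) (auto simp: epoch_Suc)

text \<open>
Geometric sums of the epoch lengths, multiplied by 3 to stay in the natural numbers:
\<open>start k = 1 + B * (4\<^sup>a - 1) / 3 + 2 * (4\<^sup>b - 1) / 3\<close>.
\<close>

lemma start_closed_form:
  "3 * start k + B = 1 + B * 4 ^ explorations k + 2 * 4 ^ exploitations k"
  by (induction k) (auto simp: epoch_Suc)

lemma strict_mono_start: "strict_mono start"
  using B_pos by (intro strict_mono_Suc_iff[THEN iffD2]) (auto simp: epoch_Suc)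

lemma start_pos: "0 < start k"
  using strict_mono_less_eq[OF strict_mono_start, of 0 k] by simp

lemma current_bounds:
  assumes "0 < t"
  shows "start (current t) \<le> t" and "t < start (Suc (current t))"
proof -
  have "t \<le> start t" using strict_mono_imp_increasing[OF strict_mono_start] .
  also have "start t < start (Suc t)" using strict_mono_start by (simp add: strict_mono_Suc_iff)
  finally show less: "t < start (Suc (current t))"
    unfolding current_def by (rule LeastI)
  show "start (current t) \<le> t"
  proof (cases "current t")
    case 0 thus ?thesis using assms by simp
  next
    case (Suc k)
    thus ?thesis using not_less_Least[of k "\<lambda>k. t < start (Suc k)"] by (auto simp: current_def)
  qed
qed

lemma le_current_iff: "0 < t \<Longrightarrow> k \<le> current t \<longleftrightarrow> start k \<le> t"
  using current_bounds[of t] strict_mono_less_eq[OF strict_mono_start, of k "current t"]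
    strict_mono_less_eq[OF strict_mono_start, of "Suc (current t)" k]
  by (cases "k \<le> current t") auto

lemma current_eq: "start k \<le> t \<Longrightarrow> t < start (Suc k) \<Longrightarrow> current t = k"
  using le_current_iff[of t k] le_current_iff[of t "Suc k"] start_pos[of k] by auto

lemma dsee_eq:
  assumes "start k \<le> Suc (length os)" "Suc (length os) < start (Suc k)"
  shows "policy os =
    (if exploiting k then best (take (start k - 1) os)
     else {j\<in>{1..N}. block (Suc (explorations k)) j
        = (Suc (length os) - start k) div 4 ^ explorations k})"
proof -
  have "epoch_at N M D (Suc (length os)) = epoch N M D k"
    using current_eq[OF assms] by (simp add: epoch_at_def current_def start_def)
  also have "\<dots> = (start k, explorations k, exploitations k)"
    by (simp add: start_def explorations_def exploitations_def)
  finally show ?thesis by (simp add: dsee_def Let_def)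
qed

lemma dsee_eq_current:
  assumes "length os = t" and "k = current (Suc t)"
  shows "policy os =
    (if exploiting k then best (take (start k - 1) os)
     else {j\<in>{1..N}. block (Suc (explorations k)) j = (Suc t - start k) div 4 ^ explorations k})"
  using dsee_eq[of k os] current_bounds[of "Suc t"] assms by simp

text \<open>
The times at which a block starts. Exploitation epochs are given fictitious blocks beyond \<open>i = 0\<close> for
the sake of a uniform formula; the set bounds the times of actual switches from above.
\<close>

definition switch_times :: "nat set" where
  "switch_times = {start k + i * 4 ^ explorations k | k i. i < B}"

text \<open>
Away from block boundaries the policy repeats its previous choice: within an exploitation epoch it
consults the same observations, and within a block the quotient that numbers the block is constant.
\<close>

lemma dsee_constant:
  assumes len: "length os = Suc t" and t: "Suc (Suc t) \<notin> switch_times"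
  shows "policy (take t os) = policy os"
proof -
  define k where "k = current (Suc (Suc t))"
  have le: "start k \<le> Suc (Suc t)" and less: "Suc (Suc t) < start (Suc k)"
    using current_bounds[of "Suc (Suc t)"] by (auto simp: k_def)
  have "start k + 0 * 4 ^ explorations k \<in> switch_times"
    unfolding switch_times_def using B_pos by blast
  hence ne: "start k \<noteq> Suc (Suc t)" using t by auto
  have "policy (take t os) =
    (if exploiting k then best (take (start k - 1) (take t os))
     else {j\<in>{1..N}. block (Suc (explorations k)) j
        = (Suc (length (take t os)) - start k) div 4 ^ explorations k})"
    using le less ne len by (intro dsee_eq) auto
  moreover have "policy os =
    (if exploiting k then best (take (start k - 1) os)
     else {j\<in>{1..N}. block (Suc (explorations k)) j
        = (Suc (length os) - start k) div 4 ^ explorations k})"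
    using le less len by (intro dsee_eq) auto
  moreover have "min (start k - 1) t = start k - 1" using le ne by auto
  moreover have "(Suc (length os) - start k) div 4 ^ explorations k
      = (Suc (length (take t os)) - start k) div 4 ^ explorations k" if "\<not> exploiting k"
  proof -
    let ?d = "Suc t - start k" and ?q = "4 ^ explorations k :: nat"
    have d: "Suc (length os) - start k = Suc ?d" "Suc (length (take t os)) - start k = ?d"
      using le ne len by auto
    have "\<not> ?q dvd Suc ?d"
    proof
      assume "?q dvd Suc ?d"
      then obtain i where i: "Suc ?d = ?q * i" by (auto elim: dvdE)
      have eq: "Suc (Suc t) = start k + i * ?q" using i le ne by (simp add: mult.commute)
      hence "i * ?q < B * ?q" using less that by (simp add: epoch_Suc)
      hence "i < B" by simp
      thus False using t eq unfolding switch_times_def by blast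
    qed
    thus ?thesis unfolding d by (simp add: div_Suc dvd_eq_mod_eq_0)
  qed
  ultimately show ?thesis by auto
qed

lemma switches_at_switch_times:
  assumes f: "follows policy h" and ne: "(j \<in> policy (observations h)) \<noteq> active (arm_past j h)"
  shows "Suc (length h) \<in> switch_times"
proof (rule ccontr)
  assume no: "Suc (length h) \<notin> switch_times"
  have "start 0 + 0 * 4 ^ explorations 0 \<in> switch_times"
    unfolding switch_times_def using B_pos by blast
  hence "length h \<noteq> 0" using no by auto
  then obtain t where t: "length h = Suc t" by (cases "length h") auto
  have "snd (last h) = policy (take t (observations h))"
    using f t by (subst last_conv_nth) (auto simp: follows_def)
  also have "\<dots> = policy (observations h)"
    using dsee_constant[of "observations h" t] no t by simp
  finally show False using ne t by (auto simp: active_arm_past)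
qed

text \<open>
Either counter is at most logarithmic in time, since the epochs of either kind grow geometrically.
\<close>

lemma epoch_number_bound: "real k \<le> 7 + 2 * ln (real (start k))"
proof -
  let ?s = "real (start k)"
  have s: "?s \<ge> 1" using start_pos[of k] by linarith
  have eq: "3 * ?s + real B = 1 + real B * 4 ^ explorations k + 2 * 4 ^ exploitations k"
    using arg_cong[OF start_closed_form[of k], of real] by simp
  have B1: "real B \<ge> 1" using B_pos by linarith
  have "(1::real) \<le> 4 ^ exploitations k" "(1::real) \<le> 4 ^ explorations k" by simp_all
  note ge1 = this
  have "real B * 1 \<le> real B * 4 ^ explorations k" by (intro mult_left_mono) auto
  hence b: "(4::real) ^ exploitations k \<le> 2 * ?s" using eq ge1 s by linarith
  have "real B * 4 ^ explorations k \<le> real B + 3 * ?s" using eq ge1 by linarith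
  hence "real B * (4 ^ explorations k - 1) \<le> 3 * ?s" by (simp add: algebra_simps)
  moreover have "1 * ((4::real) ^ explorations k - 1) \<le> real B * (4 ^ explorations k - 1)"
    using B1 by (intro mult_right_mono) auto
  ultimately have "(4::real) ^ explorations k - 1 \<le> 3 * ?s" by simp
  hence a: "(4::real) ^ explorations k \<le> 4 * ?s" using s by simp
  have "(4::real) ^ k = 4 ^ explorations k * 4 ^ exploitations k"
    using counter_sum[of k] by (simp add: power_add[symmetric])
  also have "\<dots> \<le> (4 * ?s) * (2 * ?s)"
    using a b s by (intro mult_mono) auto
  finally have "ln ((4::real) ^ k) \<le> ln (8 * (?s * ?s))"
    using s by (subst ln_le_cancel_iff) auto
  also have "\<dots> = ln 8 + 2 * ln ?s" using s by (simp add: ln_mult)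
  also have "\<dots> \<le> 7 + 2 * ln ?s" using ln_le_minus_one[of 8] by simp
  finally have "real k * ln 4 \<le> 7 + 2 * ln ?s" by (simp add: ln_realpow)
  moreover have "1 \<le> ln (4::real)"
    using exp_le by (subst ln_ge_iff) auto
  ultimately show ?thesis using mult_left_mono[of 1 "ln 4" "real k"] by simp
qed

lemma switch_times_bound:
  "real (card (switch_times \<inter> {1..t})) \<le> B * (8 + 2 * ln (real t))"
proof (cases "t = 0")
  case False
  hence t: "0 < t" by simp
  have "switch_times \<inter> {1..t} \<subseteq> (\<lambda>(k, i). start k + i * 4 ^ explorations k) ` ({..current t} \<times> {..<B})"
    using t by (force simp: switch_times_def le_current_iff)
  hence "card (switch_times \<inter> {1..t})
      \<le> card ((\<lambda>(k, i). start k + i * 4 ^ explorations k) ` ({..current t} \<times> {..<B}))"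
    by (intro card_mono) auto
  also have "\<dots> \<le> card ({..current t} \<times> {..<B})" by (intro card_image_le) auto
  also have "\<dots> = B * (current t + 1)" by (simp add: card_cartesian_product)
  finally have "real (card (switch_times \<inter> {1..t})) \<le> real (B * (current t + 1))" by linarith
  also have "\<dots> = B * (real (current t) + 1)" by (simp add: algebra_simps)
  also have "\<dots> \<le> B * (8 + 2 * ln (real t))"
  proof (intro mult_left_mono)
    have "ln (real (start (current t))) \<le> ln (real t)"
      using current_bounds(1)[OF t] start_pos[of "current t"] t by (subst ln_le_cancel_iff) auto
    thus "real (current t) + 1 \<le> 8 + 2 * ln (real t)"
      using epoch_number_bound[of "current t"] by linarith
  qed auto
  finally show ?thesis .
qed simp

lemma exploration_length_before_epoch:
  "3 * card {t\<in>{1..<start k}. \<not> exploiting (current t)} + B \<le> B * 4 ^ explorations k"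
proof (induction k)
  case (Suc k)
  have split: "{t\<in>{1..<start (Suc k)}. \<not> exploiting (current t)}
      = {t\<in>{1..<start k}. \<not> exploiting (current t)}
        \<union> (if exploiting k then {} else {start k..<start (Suc k)})"
  proof (rule set_eqI)
    fix t
    have "t < start k \<Longrightarrow> t < start (Suc k)"
      using strict_mono_less[OF strict_mono_start, of k "Suc k"] by simp
    moreover have "start k \<le> t \<Longrightarrow> t < start (Suc k) \<Longrightarrow> current t = k" by (rule current_eq)
    ultimately show "t \<in> {t\<in>{1..<start (Suc k)}. \<not> exploiting (current t)} \<longleftrightarrow>
        t \<in> {t\<in>{1..<start k}. \<not> exploiting (current t)}
          \<union> (if exploiting k then {} else {start k..<start (Suc k)})"
      using start_pos[of k] by (cases "t < start k") auto
  qed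
  have "card {t\<in>{1..<start (Suc k)}. \<not> exploiting (current t)}
      \<le> card {t\<in>{1..<start k}. \<not> exploiting (current t)}
        + card (if exploiting k then {} else {start k..<start (Suc k)})"
    unfolding split by (rule card_Un_le)
  thus ?case using Suc by (auto simp: epoch_Suc split: if_splits)
qed simp

text \<open>
The last exploration epoch was started when the exploration time per arm was still below
\<open>D t * ln t\<close>, and one epoch multiplies this time by 4, up to the additive constant.
\<close>

lemma exploration_parameter_bound:
  assumes mono: "mono_on {1..} D" and D: "0 \<le> D t" and k: "start k \<le> t"
  shows "(4 ^ explorations (Suc k) - 1) / 3 \<le> 4 * (D t * ln (real t)) + 1"
  using k
proof (induction k)
  case 0
  thus ?case using D by (simp add: epoch_Suc)
next
  case (Suc k)
  let ?k = "Suc k"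
  show ?case
  proof (cases "exploiting ?k")
    case True
    have "start k \<le> t" using Suc.prems strict_mono_less[OF strict_mono_start, of k "Suc k"] by simp
    thus ?thesis using Suc.IH True by (simp add: epoch_Suc)
  next
    case False
    have s: "1 \<le> real (start ?k)" "real (start ?k) \<le> t" using start_pos[of ?k] Suc.prems by auto
    have "(4 ^ explorations ?k - 1) / 3 \<le> D (start ?k) * ln (real (start ?k))"
      using False by (simp add: exploits_def)
    also have "\<dots> \<le> D t * ln (real (start ?k))"
      using s start_pos[of ?k] Suc.prems by (intro mult_right_mono mono_onD[OF mono]) auto
    also have "\<dots> \<le> D t * ln (real t)"
      using s D by (intro mult_left_mono) auto
    finally show ?thesis using False by (simp add: epoch_Suc(2)[of ?k])
  qed
qed

lemma exploration_time_bound: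
  assumes mono: "mono_on {1..} D" and D: "0 \<le> D t"
  shows "real (card {s\<in>{1..t}. \<not> exploiting (current s)}) \<le> B * (4 * (D t * ln (real t)) + 1)"
proof (cases "t = 0")
  case False
  let ?k = "current t"
  have t: "start ?k \<le> t" "t < start (Suc ?k)" using current_bounds[of t] False by auto
  have "card {s\<in>{1..t}. \<not> exploiting (current s)}
      \<le> card {s\<in>{1..<start (Suc ?k)}. \<not> exploiting (current s)}"
    using t by (intro card_mono) auto
  hence "3 * card {s\<in>{1..t}. \<not> exploiting (current s)} + B \<le> B * 4 ^ explorations (Suc ?k)"
    using exploration_length_before_epoch[of "Suc ?k"] by linarith
  hence "real (3 * card {s\<in>{1..t}. \<not> exploiting (current s)} + B) \<le> real (B * 4 ^ explorations (Suc ?k))"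
    by linarith
  hence "real (card {s\<in>{1..t}. \<not> exploiting (current s)})
      \<le> B * ((4 ^ explorations (Suc ?k) - 1) / 3)" by (simp add: algebra_simps)
  also have "\<dots> \<le> B * (4 * (D t * ln (real t)) + 1)"
    using exploration_parameter_bound[OF mono D t(1)] by (intro mult_left_mono) auto
  finally show ?thesis .
qed simp

text \<open>
The earlier exploitation epochs already take time proportional to the present one, so a bound of
order \<open>1 / start k\<close> is a bound of order \<open>1 / t\<close> throughout the epoch.
\<close>

lemma exploitation_epoch_length:
  assumes "exploiting k" "t < start (Suc k)"
  shows "t \<le> 4 * start k"
proof -
  have "B \<le> B * 4 ^ explorations k" by simp
  moreover have "t < start k + 2 * 4 ^ exploitations k" using assms by (simp add: epoch_Suc)
  ultimately show ?thesis using start_closed_form[of k] by linarith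
qed

text \<open>
Each exploration epoch contributes its own block of plays of arm \<open>j\<close>, whatever the observations are.
The inequality is proved for the set \<open>A k\<close> of list indices, which are the times shifted by one.
\<close>

lemma plays_before_epoch:
  assumes f: "follows policy h" and j: "j \<in> {1..N}" and k: "start k \<le> Suc (length h)"
  shows "(4 ^ explorations k - 1) / 3 \<le> real (plays (arm_past j h))"
proof -
  define A where "A k = {i. Suc i < start k \<and> j \<in> snd (h ! i)}" for k
  have finA: "finite (A k)" for k
    by (rule finite_subset[of _ "{..<start k}"]) (auto simp: A_def)
  have "4 ^ explorations k \<le> 3 * card (A k) + 1"
    using k
  proof (induction k)
    case 0 thus ?case by simp
  next
    case (Suc k)
    let ?q = "4 ^ explorations k :: nat"
    have less: "start k < start (Suc k)" by (rule strict_monoD[OF strict_mono_start]) simp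
    hence IH: "?q \<le> 3 * card (A k) + 1" using Suc by simp
    show ?case
    proof (cases "exploiting k")
      case True
      have "card (A k) \<le> card (A (Suc k))"
        using less by (intro card_mono finA) (auto simp: A_def)
      thus ?thesis using IH True by (simp add: epoch_Suc)
    next
      case False
      define c where "c = block (Suc (explorations k)) j"
      have c: "c < B" using blocks j by (simp add: block_assignment_def c_def)
      let ?J = "{start k + c * ?q - 1..<start k + c * ?q - 1 + ?q}"
      have "(c + 1) * ?q \<le> B * ?q" using c by (intro mult_right_mono) auto
      hence J: "start k + c * ?q + ?q \<le> start (Suc k)" using False by (simp add: epoch_Suc)
      have "?J \<subseteq> A (Suc k)"
      proof
        fix i assume i: "i \<in> ?J"
        have i1: "start k + c * ?q \<le> Suc i" "Suc i < start k + c * ?q + ?q"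
          using i start_pos[of k] by auto
        have len: "i < length h" using i1 J Suc.prems by simp
        have "(Suc i - start k) div ?q = c"
        proof -
          have "Suc i - start k = c * ?q + (Suc i - start k - c * ?q)" using i1 by simp
          moreover have "Suc i - start k - c * ?q < ?q" using i1 by simp
          ultimately show ?thesis by (metis div_less div_mult_self3 add.right_neutral power_not_zero zero_neq_numeral)
        qed
        moreover have "snd (h ! i) = policy (take i (observations h))"
          using f len by (simp add: follows_def)
        moreover have "policy (take i (observations h)) =
            {j\<in>{1..N}. block (Suc (explorations k)) j = (Suc i - start k) div ?q}"
          using dsee_eq[of k "take i (observations h)"] len i1 J False by simp
        ultimately have "j \<in> snd (h ! i)" using j by (simp add: c_def)
        thus "i \<in> A (Suc k)" using i1 J by (simp add: A_def)
      qed
      moreover have "A k \<subseteq> A (Suc k)" using less by (auto simp: A_def)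
      ultimately have "card (A k \<union> ?J) \<le> card (A (Suc k))"
        by (intro card_mono finA) auto
      moreover have "card (A k \<union> ?J) = card (A k) + card ?J"
        by (rule card_Un_disjoint) (simp_all add: finA, auto simp: A_def)
      ultimately have "card (A k) + ?q \<le> card (A (Suc k))" by simp
      thus ?thesis using IH False by (simp add: epoch_Suc)
    qed
  qed
  also have "card (A k) \<le> plays (arm_past j h)"
    unfolding plays_arm_past A_def using k by (intro card_mono) auto
  finally have "4 ^ explorations k \<le> 3 * plays (arm_past j h) + 1" by simp
  hence "real (4 ^ explorations k) \<le> real (3 * plays (arm_past j h) + 1)" by linarith
  thus ?thesis by simp
qed

end

section \<open>The probability of selecting inferior arms\<close>

text \<open>
The common part of both sets cancels, and some threshold \<open>c\<close> separates the values on the rests.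
\<close>

lemma sum_dominating_set:
  fixes \<mu> :: "nat \<Rightarrow> real"
  assumes fin: "finite A" "finite C" and card: "card A = card C"
    and dom: "\<And>i j. i \<in> A \<Longrightarrow> j \<in> C - A \<Longrightarrow> \<mu> j \<le> \<mu> i"
  shows "sum \<mu> C \<le> sum \<mu> A"
proof -
  have "card (C - A) = card (A - C)"
    using fin card by (simp add: card_Diff_subset_Int Int_commute)
  moreover obtain c where c: "\<And>i. i \<in> A - C \<Longrightarrow> c \<le> \<mu> i" "\<And>j. j \<in> C - A \<Longrightarrow> \<mu> j \<le> c"
  proof (cases "A - C = {}")
    case True
    hence "C - A = {}" using calculation fin by (metis card_0_eq finite_Diff)
    thus ?thesis using True that by blast
  next
    case False
    have fin': "finite (\<mu> ` (A - C))" using fin by simp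
    show ?thesis
    proof (rule that[of "Min (\<mu> ` (A - C))"])
      show "Min (\<mu> ` (A - C)) \<le> \<mu> i" if "i \<in> A - C" for i using that fin' by auto
      show "\<mu> j \<le> Min (\<mu> ` (A - C))" if "j \<in> C - A" for j
        using that fin' False dom by (subst Min_ge_iff) auto
    qed
  qed
  have "sum \<mu> (C - A) \<le> of_nat (card (C - A)) * c" by (rule sum_bounded_above) (use c in auto)
  moreover have "of_nat (card (A - C)) * c \<le> sum \<mu> (A - C)" by (rule sum_bounded_below) (use c in auto)
  moreover have "sum \<mu> C = sum \<mu> (C - A) + sum \<mu> (A \<inter> C)" "sum \<mu> A = sum \<mu> (A - C) + sum \<mu> (A \<inter> C)"
    using fin by (simp_all add: sum.Int_Diff[of C \<mu> A] sum.Int_Diff[of A \<mu> C] Int_commute)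
  ultimately show ?thesis by simp
qed

locale dsee_bandit = restless_arms N S P \<iota> Q + dsee_epochs N M D block best
  for N S P \<iota> Q M D block best +
  fixes \<mu> :: "nat \<Rightarrow> real" and \<sigma> :: "nat \<Rightarrow> nat" and g :: "nat \<Rightarrow> real \<Rightarrow> real" and G :: real
  assumes M_le: "M \<le> N"
    and mono_D: "mono_on {1..} D" and D_lim: "filterlim D at_top at_top"
    and selection: "best_selection N M best"
    and \<sigma>: "\<sigma> permutes {1..N}"
    and sorted: "1 \<le> i \<Longrightarrow> i \<le> j \<Longrightarrow> j \<le> N \<Longrightarrow> \<mu> (\<sigma> j) \<le> \<mu> (\<sigma> i)"
    and poisson: "j \<in> {1..N} \<Longrightarrow> x \<in> S j \<Longrightarrow> g j x - measure_pmf.expectation (P j x) (g j) = x - \<mu> j"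
    and G: "j \<in> {1..N} \<Longrightarrow> x \<in> S j \<Longrightarrow> \<bar>g j x\<bar> \<le> G" "0 < G"
begin

abbreviation best_value :: real where "best_value \<equiv> (\<Sum>i=1..M. \<mu> (\<sigma> i))"

abbreviation dlaw :: "nat \<Rightarrow> history pmf" where "dlaw t \<equiv> law policy t"

lemma follows_law: "h \<in> set_pmf (dlaw t) \<Longrightarrow> follows policy h"
  using law_history[of h policy t] by (auto simp: follows_def)

lemma poisson_arm_dsee:
  assumes "j \<in> {1..N}"
  shows "poisson_arm N S P \<iota> Q j (g j) (\<mu> j) G policy switch_times"
proof unfold_locales
  fix h t assume h: "h \<in> set_pmf (dlaw t)"
    and ne: "(j \<in> policy (observations h)) \<noteq> active (arm_past j h)"
  thus "Suc t \<in> switch_times"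
    using switches_at_switch_times[OF follows_law[OF h] ne] law_history(1)[OF h] by simp
qed (use assms poisson[OF assms] G in auto)

lemma inj_\<sigma>: "inj_on \<sigma> A"
  using permutes_inj[OF \<sigma>] by (rule inj_on_subset) simp

lemma \<sigma>_image_subset: "\<sigma> ` {1..M} \<subseteq> {1..N}"
  using permutes_image[OF \<sigma>] M_le by (metis atLeastatMost_subset_iff image_mono order_refl)

lemma best_value_eq: "best_value = sum \<mu> (\<sigma> ` {1..M})"
  by (simp add: sum.reindex[OF inj_\<sigma>])

text \<open>
If all sample means are within \<open>\<delta>\<close> of the mean rewards, then an arm that is passed over is better by
at most \<open>2 * \<delta>\<close>, hence, by the gap between distinct values, not better at all.
\<close>

lemma accurate_selection_optimal:
  assumes gap: "\<And>i j. i \<in> {1..N} \<Longrightarrow> j \<in> {1..N} \<Longrightarrow> \<mu> i < \<mu> j \<Longrightarrow> \<mu> i + 2 * \<delta> < \<mu> j"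
    and acc: "\<And>j. j \<in> {1..N} \<Longrightarrow> \<bar>sample_mean j os - \<mu> j\<bar> \<le> \<delta>"
  shows "sum \<mu> (best os) = best_value"
proof (rule antisym)
  have b: "best os \<subseteq> {1..N}" "card (best os) = M"
    and b_top: "\<And>i j. i \<in> best os \<Longrightarrow> j \<in> {1..N} - best os \<Longrightarrow> sample_mean j os \<le> sample_mean i os"
    using selection by (auto simp: best_selection_def)
  have fin: "finite (best os)" using b(1) finite_subset by blast
  have card: "card (\<sigma> ` {1..M}) = card (best os)" by (simp add: card_image[OF inj_\<sigma>] b)
  show "sum \<mu> (best os) \<le> best_value" unfolding best_value_eq
  proof (rule sum_dominating_set[OF _ fin card])
    fix i j assume i: "i \<in> \<sigma> ` {1..M}" and j: "j \<in> best os - \<sigma> ` {1..M}"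
    obtain a where a: "i = \<sigma> a" "a \<in> {1..M}" using i by auto
    have "j \<in> \<sigma> ` {1..N}" using j b(1) permutes_image[OF \<sigma>] by auto
    then obtain c where c: "j = \<sigma> c" "c \<in> {1..N}" by auto
    show "\<mu> j \<le> \<mu> i" unfolding a(1) c(1) using a c j by (intro sorted) auto
  qed simp
  show "best_value \<le> sum \<mu> (best os)" unfolding best_value_eq
  proof (rule sum_dominating_set[OF fin _ card[symmetric]])
    fix i j assume i: "i \<in> best os" and j: "j \<in> \<sigma> ` {1..M} - best os"
    have ij: "i \<in> {1..N}" "j \<in> {1..N}" using i j b(1) \<sigma>_image_subset by auto
    have "\<mu> j \<le> \<mu> i + 2 * \<delta>"
      using b_top[OF i, of j] ij j acc[OF ij(1)] acc[OF ij(2)] by auto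
    thus "\<mu> j \<le> \<mu> i" using gap[OF ij] by linarith
  qed simp
qed

lemma gap_exists:
  obtains \<delta> where "\<delta> > 0"
    and "\<And>i j. i \<in> {1..N} \<Longrightarrow> j \<in> {1..N} \<Longrightarrow> \<mu> i < \<mu> j \<Longrightarrow> \<mu> i + 2 * \<delta> < \<mu> j"
proof -
  define R where "R = insert 1 ({0<..} \<inter> (\<lambda>(i, j). \<mu> j - \<mu> i) ` ({1..N} \<times> {1..N}))"
  have R: "finite R" "R \<noteq> {}" by (auto simp: R_def)
  have pos: "Min R > 0" using R by (subst Min_gr_iff) (auto simp: R_def)
  show ?thesis
  proof (rule that[of "Min R / 3"])
    fix i j assume "i \<in> {1..N}" "j \<in> {1..N}" "\<mu> i < \<mu> j"
    hence "\<mu> j - \<mu> i \<in> R" unfolding R_def by force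
    hence "Min R \<le> \<mu> j - \<mu> i" using R by simp
    thus "\<mu> i + 2 * (Min R / 3) < \<mu> j" using pos by linarith
  qed (use pos in simp)
qed

abbreviation wrong :: "history set" where
  "wrong \<equiv> {h. sum \<mu> (best (observations h)) \<noteq> best_value}"

text \<open>
At the start \<open>s\<close> of an exploitation epoch every arm has been played more than \<open>X = D s * ln s\<close> times,
so a sample mean is wrong by \<open>\<delta>\<close> with probability at most \<open>2 * exp (- const * D s * ln s)\<close>, which is
\<open>2 / s\<close> or less once \<open>D s\<close> exceeds a constant. The divergence of \<open>D\<close> thus replaces knowledge of the
arms, and it also makes the \<open>O(ln s)\<close> boundary terms small compared to \<open>X\<close>.
\<close>

lemma wrong_selection_probability:
  obtains K where "K \<ge> 0"
    and "\<And>k. exploiting k \<Longrightarrow> measure_pmf.prob (dlaw (start k - 1)) wrong \<le> K / start k"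
proof -
  obtain \<delta> where d: "\<delta> > 0"
    and gap: "\<And>i j. i \<in> {1..N} \<Longrightarrow> j \<in> {1..N} \<Longrightarrow> \<mu> i < \<mu> j \<Longrightarrow> \<mu> i + 2 * \<delta> < \<mu> j"
    using gap_exists by blast
  \<comment> \<open>The first bound on \<open>D\<close> absorbs the boundary terms, of which there are at most \<open>10 * B * ln s\<close>;
    the second one makes the exponent at least \<open>ln s\<close>.\<close>
  define c where "c = max (4 * G * (1 + 10 * real B) / \<delta>) (16 * G\<^sup>2 / \<delta>\<^sup>2)"
  have c1: "4 * G * (1 + 10 * real B) / \<delta> \<le> c" and c2: "16 * G\<^sup>2 / \<delta>\<^sup>2 \<le> c" by (auto simp: c_def)
  have c0: "0 < c" using c2 G(2) d by (smt (verit) divide_pos_pos zero_less_power)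
  have "\<forall>\<^sub>F s in at_top. D s \<ge> c" using D_lim by (auto simp: filterlim_at_top)
  then obtain s0 where s0: "\<And>s. s \<ge> s0 \<Longrightarrow> D s \<ge> c" by (auto simp: eventually_at_top_linorder)
  \<comment> \<open>The summand \<open>s0 + 3\<close> makes the bound trivial for the finitely many early epochs; from time 3 on,
    \<open>ln s\<close> is at least 1.\<close>
  define K where "K = 2 * real N + (s0 + 3)"
  show ?thesis
  proof (rule that[of K])
    show "0 \<le> K" by (simp add: K_def)
  next
    fix k assume k: "exploiting k"
    let ?s = "start k" and ?p = "measure_pmf.prob (dlaw (start k - 1))"
    have s1: "1 \<le> real ?s" using start_pos[of k] by linarith
    show "?p wrong \<le> K / ?s"
    proof (cases "?s \<ge> s0 + 3")
      case False
      have "?p wrong \<le> 1" by simp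
      also have "1 \<le> K / ?s" using False s1 by (simp add: K_def)
      finally show ?thesis .
    next
      case True
      have D: "D ?s \<ge> c" using s0 True by simp
      have "exp 1 \<le> real ?s" using True exp_le by linarith
      hence ln1: "1 \<le> ln (real ?s)" using s1 by (subst ln_ge_iff) auto
      define X where "X = D ?s * ln (real ?s)"
      have cX: "c * ln (real ?s) \<le> X" unfolding X_def using D ln1 by (intro mult_right_mono) auto
      have "0 < c * ln (real ?s)" using c0 ln1 by (intro mult_pos_pos) auto
      hence X0: "0 < X" using cX by linarith
      have small: "G * (1 + card (switch_times \<inter> {1..?s - 1})) \<le> \<delta> * X / 4"
      proof -
        have "card (switch_times \<inter> {1..?s - 1}) \<le> card (switch_times \<inter> {1..?s})"
          by (intro card_mono) auto
        hence "real (card (switch_times \<inter> {1..?s - 1})) \<le> B * (8 + 2 * ln (real ?s))"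
          using switch_times_bound[of ?s] by linarith
        also have "\<dots> \<le> B * (10 * ln (real ?s))" using ln1 by (intro mult_left_mono) auto
        finally have "1 + real (card (switch_times \<inter> {1..?s - 1})) \<le> (1 + 10 * real B) * ln (real ?s)"
          using ln1 by (simp add: algebra_simps)
        hence "G * (1 + real (card (switch_times \<inter> {1..?s - 1}))) \<le> G * ((1 + 10 * real B) * ln (real ?s))"
          using G(2) by (intro mult_left_mono) auto
        also have "\<dots> = \<delta> * ((4 * G * (1 + 10 * real B) / \<delta>) * ln (real ?s)) / 4"
          using d by simp
        also have "\<dots> \<le> \<delta> * (c * ln (real ?s)) / 4"
          using c1 ln1 d by (intro divide_right_mono mult_left_mono mult_right_mono) auto
        also have "\<dots> \<le> \<delta> * X / 4" using cX d by simp
        finally show ?thesis by simp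
      qed
      have "16 * G\<^sup>2 / \<delta>\<^sup>2 * ln (real ?s) \<le> c * ln (real ?s)"
        using c2 ln1 by (intro mult_right_mono) auto
      hence "16 * G\<^sup>2 / \<delta>\<^sup>2 * ln (real ?s) \<le> X" using cX by linarith
      hence "ln (real ?s) \<le> \<delta>\<^sup>2 * X / (16 * G\<^sup>2)" using d G(2) by (simp add: field_simps)
      hence "exp (- (\<delta>\<^sup>2 * X / (16 * G\<^sup>2))) \<le> exp (- ln (real ?s))" by simp
      also have "\<dots> = 1 / ?s" using s1 by (simp add: exp_minus inverse_eq_divide)
      finally have exp_le: "exp (- (\<delta>\<^sup>2 * X / (16 * G\<^sup>2))) \<le> 1 / ?s" .
      have dev: "?p {h. \<bar>sample_mean j (observations h) - \<mu> j\<bar> > \<delta>} \<le> 2 * (1 / ?s)"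
        if j: "j \<in> {1..N}" for j
      proof -
        interpret poisson_arm N S P \<iota> Q j "g j" "\<mu> j" G policy switch_times
          by (rule poisson_arm_dsee[OF j])
        have "?p {h. \<bar>sample_mean j (observations h) - \<mu> j\<bar> > \<delta>} \<le> 2 * exp (- (\<delta>\<^sup>2 * X / (16 * G\<^sup>2)))"
        proof (rule sample_mean_deviation[OF d dsee_bandit.G(2)[OF dsee_bandit_axioms] X0])
          show "G * (1 + switch_count (start k - 1)) \<le> \<delta> * X / 4"
            using small by (simp add: switch_count_def)
          fix h assume h: "h \<in> set_pmf (dlaw (start k - 1))"
          have "X < (4 ^ explorations k - 1) / 3" using k by (simp add: exploits_def X_def)
          also have "\<dots> \<le> real (plays (arm_past j h))"
            using law_history(1)[OF h] start_pos[of k]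
            by (intro plays_before_epoch[OF follows_law[OF h] j]) simp
          finally show "X \<le> real (plays (arm_past j h))" by simp
        qed
        thus ?thesis using exp_le by linarith
      qed
      have "wrong \<subseteq> (\<Union>j\<in>{1..N}. {h. \<bar>sample_mean j (observations h) - \<mu> j\<bar> > \<delta>})"
      proof
        fix h assume "h \<in> wrong"
        hence "\<not> (\<forall>j\<in>{1..N}. \<bar>sample_mean j (observations h) - \<mu> j\<bar> \<le> \<delta>)"
          using accurate_selection_optimal[OF gap, where os = "observations h"] by blast
        thus "h \<in> (\<Union>j\<in>{1..N}. {h. \<bar>sample_mean j (observations h) - \<mu> j\<bar> > \<delta>})"
          by (auto simp: not_le)
      qed
      hence "?p wrong \<le> ?p (\<Union>j\<in>{1..N}. {h. \<bar>sample_mean j (observations h) - \<mu> j\<bar> > \<delta>})"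
        by (intro measure_pmf.finite_measure_mono) auto
      also have "\<dots> \<le> (\<Sum>j\<in>{1..N}. ?p {h. \<bar>sample_mean j (observations h) - \<mu> j\<bar> > \<delta>})"
        by (rule measure_pmf.finite_measure_subadditive_finite) auto
      also have "\<dots> \<le> (\<Sum>j\<in>{1..N}. 2 * (1 / ?s))" by (intro sum_mono dev)
      also have "\<dots> \<le> K / ?s" by (simp add: K_def divide_right_mono)
      finally show ?thesis .
    qed
  qed
qed

section \<open>The regret\<close>

text \<open>
The expected loss, in terms of mean rewards, of the decision taken after \<open>i\<close> time steps.
\<close>

definition loss :: "nat \<Rightarrow> real" where
  "loss i = measure_pmf.expectation (dlaw i) (\<lambda>h. best_value - sum \<mu> (policy (observations h)))"

lemma policy_subset: "policy os \<subseteq> {1..N}"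
  using selection unfolding dsee_eq_current[OF refl refl] by (auto simp: best_selection_def)

lemma abs_loss_le:
  assumes "A \<subseteq> {1..N}"
  shows "\<bar>best_value - sum \<mu> A\<bar> \<le> 2 * (\<Sum>j=1..N. \<bar>\<mu> j\<bar>)"
proof -
  have bound: "\<bar>sum \<mu> A\<bar> \<le> (\<Sum>j=1..N. \<bar>\<mu> j\<bar>)" if "A \<subseteq> {1..N}" for A
    using that by (intro order_trans[OF sum_abs] sum_mono2) auto
  show ?thesis
    using bound[OF assms] bound[OF \<sigma>_image_subset] unfolding best_value_eq by linarith
qed

lemma loss_exploitation:
  assumes k: "k = current (Suc i)" "exploiting k"
    and K: "measure_pmf.prob (dlaw (start k - 1)) wrong \<le> K / start k" "0 \<le> K"
  shows "\<bar>loss i\<bar> \<le> 2 * (\<Sum>j=1..N. \<bar>\<mu> j\<bar>) * (4 * K / Suc i)"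
proof -
  let ?C = "2 * (\<Sum>j=1..N. \<bar>\<mu> j\<bar>)" and ?n = "start k - 1"
  have C0: "0 \<le> ?C" by (simp add: sum_nonneg)
  have k_le: "start k \<le> Suc i" "Suc i < start (Suc k)" using current_bounds[of "Suc i"] k(1) by auto
  have s: "0 < start k" by (rule start_pos)
  have "\<bar>loss i\<bar> \<le> measure_pmf.expectation (dlaw i) (\<lambda>h. \<bar>best_value - sum \<mu> (policy (observations h))\<bar>)"
    unfolding loss_def by (rule integral_abs_bound)
  also have "\<dots> \<le> measure_pmf.expectation (dlaw i) (\<lambda>h. ?C * indicator wrong (take ?n h))"
  proof (rule expectation_mono_finite[OF finite_law])
    fix h assume h: "h \<in> set_pmf (dlaw i)"
    have "policy (observations h) = best (observations (take ?n h))"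
      using dsee_eq_current[of "observations h" i k] k law_history(1)[OF h]
      by (simp add: observations_take)
    thus "\<bar>best_value - sum \<mu> (policy (observations h))\<bar> \<le> ?C * indicator wrong (take ?n h)"
      using abs_loss_le[OF policy_subset, of "observations h"] by (auto simp: indicator_def)
  qed
  also have "\<dots> = ?C * measure_pmf.expectation (map_pmf (take ?n) (dlaw i)) (indicator wrong)"
    by (simp only: integral_map_pmf integral_mult_right_zero)
  also have "map_pmf (take ?n) (dlaw i) = dlaw ?n"
    using k_le by (intro map_take_bandit_law) simp
  also have "measure_pmf.expectation (dlaw ?n) (indicator wrong) = measure_pmf.prob (dlaw ?n) wrong"
    by simp
  also have "?C * \<dots> \<le> ?C * (4 * K / Suc i)"
  proof (intro mult_left_mono C0 order_trans[OF K(1)])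
    have "real (Suc i) \<le> 4 * real (start k)"
      using exploitation_epoch_length[OF k(2) k_le(2)] by linarith
    hence "K * real (Suc i) \<le> K * (4 * real (start k))" using K(2) by (rule mult_left_mono)
    thus "K / start k \<le> 4 * K / Suc i" using s by (simp add: field_simps)
  qed
  finally show ?thesis .
qed

text \<open>
Exploitation contributes a harmonic sum, and every exploration slot contributes at most a constant.
\<close>

lemma loss_sum_bound:
  obtains K where "K \<ge> 0"
    and "\<And>t. 0 < t \<Longrightarrow> 0 \<le> D t \<Longrightarrow>
      \<bar>\<Sum>i<t. loss i\<bar> \<le> K * (1 + ln (real t)) + K * (D t * ln (real t) + 1)"
proof -
  let ?C = "2 * (\<Sum>j=1..N. \<bar>\<mu> j\<bar>)"
  have C0: "0 \<le> ?C" by (simp add: sum_nonneg)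
  obtain K where K0: "K \<ge> 0"
    and K: "\<And>k. exploiting k \<Longrightarrow> measure_pmf.prob (dlaw (start k - 1)) wrong \<le> K / start k"
    using wrong_selection_probability by blast
  have loss: "\<bar>loss i\<bar> \<le> ?C * (4 * K / Suc i + of_bool (\<not> exploiting (current (Suc i))))" for i
  proof (cases "exploiting (current (Suc i))")
    case True
    thus ?thesis using loss_exploitation[OF refl True K[OF True] K0] by simp
  next
    case False
    have "\<bar>loss i\<bar> \<le> ?C" unfolding loss_def
      by (rule abs_expectation_le_finite[OF finite_law]) (rule abs_loss_le[OF policy_subset])
    also have "\<dots> \<le> ?C * (4 * K / Suc i + of_bool (\<not> exploiting (current (Suc i))))"
      using False K0 C0 mult_left_mono[of 1 "4 * K / Suc i + 1" ?C] by simp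
    finally show ?thesis .
  qed
  define K' where "K' = ?C * (4 * K + 4 * B)"
  show ?thesis
  proof (rule that[of K'])
    show "0 \<le> K'" unfolding K'_def using C0 K0 by (intro mult_nonneg_nonneg) auto
    fix t :: nat assume t: "0 < t" and D: "0 \<le> D t"
    have ln0: "0 \<le> ln (real t)" using t by simp
    have X0: "0 \<le> D t * ln (real t)" using D ln0 by simp
    have count: "(\<Sum>i<t. of_bool (\<not> exploiting (current (Suc i))) :: real)
        = card {s\<in>{1..t}. \<not> exploiting (current s)}"
    proof -
      have "(\<Sum>i<t. of_bool (\<not> exploiting (current (Suc i))) :: real)
          = (\<Sum>s\<in>{1..t}. of_bool (\<not> exploiting (current s)))"
        by (rule sum.reindex_bij_witness[of _ "\<lambda>s. s - 1" Suc]) auto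
      thus ?thesis by (simp add: of_bool_def sum.If_cases Int_def)
    qed
    have harm: "(\<Sum>i<t. 1 / real (Suc i)) \<le> 1 + ln (real t)"
      using euler_mascheroni_sequence_decreasing[of 1 t] t
      by (simp add: harm_altdef inverse_eq_divide)
    have "\<bar>\<Sum>i<t. loss i\<bar> \<le> (\<Sum>i<t. \<bar>loss i\<bar>)" by (rule sum_abs)
    also have "\<dots> \<le> (\<Sum>i<t. ?C * (4 * K / Suc i + of_bool (\<not> exploiting (current (Suc i)))))"
      by (intro sum_mono loss)
    also have "\<dots> = ?C * (4 * K * (\<Sum>i<t. 1 / real (Suc i)) + card {s\<in>{1..t}. \<not> exploiting (current s)})"
      by (simp add: sum_distrib_left[symmetric] sum.distrib count del: of_nat_Suc) (simp add: sum_distrib_left)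
    also have "\<dots> \<le> ?C * (4 * K * (1 + ln (real t)) + B * (4 * (D t * ln (real t)) + 1))"
      using harm exploration_time_bound[OF mono_D D] K0 C0
      by (intro mult_left_mono add_mono) auto
    also have "\<dots> \<le> ?C * ((4 * K + 4 * B) * (1 + ln (real t)) + (4 * K + 4 * B) * (D t * ln (real t) + 1))"
    proof (intro mult_left_mono C0 add_mono)
      show "4 * K * (1 + ln (real t)) \<le> (4 * K + 4 * B) * (1 + ln (real t))"
        using ln0 by (intro mult_right_mono) auto
      have "real B * (4 * (D t * ln (real t)) + 1) \<le> 4 * real B * (D t * ln (real t) + 1)"
        using X0 by (simp add: algebra_simps)
      also have "\<dots> \<le> (4 * K + 4 * B) * (D t * ln (real t) + 1)"
        using X0 K0 by (intro mult_right_mono) auto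
      finally show "real B * (4 * (D t * ln (real t)) + 1) \<le> (4 * K + 4 * B) * (D t * ln (real t) + 1)" .
    qed
    finally show "\<bar>\<Sum>i<t. loss i\<bar> \<le> K' * (1 + ln (real t)) + K' * (D t * ln (real t) + 1)"
      by (simp add: K'_def algebra_simps)
  qed
qed

lemma pseudo_regret:
  "real t * best_value - (\<Sum>j=1..N. \<mu> j * measure_pmf.expectation (dlaw t) (\<lambda>h. plays (arm_past j h)))
    = (\<Sum>i<t. loss i)"
proof (induction t)
  case 0 show ?case by (simp add: plays_def)
next
  case (Suc t)
  let ?E = "measure_pmf.expectation"
  have step: "?E (dlaw (Suc t)) (\<lambda>h. plays (arm_past j h))
      = ?E (dlaw t) (\<lambda>h. plays (arm_past j h)) + ?E (dlaw t) (\<lambda>h. of_bool (j \<in> policy (observations h)))"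
    if "j \<in> {1..N}" for j
    using expectation_law_Suc[OF that, where F = "\<lambda>p. real (plays p)" and \<phi> = policy and t = t]
    by (simp add: integrable_measure_pmf_finite[OF finite_law] del: bandit_law.simps)
  have "(\<Sum>j=1..N. \<mu> j * ?E (dlaw t) (\<lambda>h. of_bool (j \<in> policy (observations h))))
      = ?E (dlaw t) (\<lambda>h. \<Sum>j=1..N. \<mu> j * of_bool (j \<in> policy (observations h)))"
    by (subst Bochner_Integration.integral_sum) (simp_all add: integrable_measure_pmf_finite[OF finite_law])
  also have "\<dots> = ?E (dlaw t) (\<lambda>h. sum \<mu> (policy (observations h)))"
  proof (rule expectation_cong)
    fix h
    show "(\<Sum>j=1..N. \<mu> j * of_bool (j \<in> policy (observations h))) = sum \<mu> (policy (observations h))"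
      using policy_subset[of "observations h"]
      by (simp add: Int_absorb1)
  qed
  also have "\<dots> = best_value - loss t"
    unfolding loss_def by (simp add: integrable_measure_pmf_finite[OF finite_law])
  finally have "(\<Sum>j=1..N. \<mu> j * ?E (dlaw t) (\<lambda>h. of_bool (j \<in> policy (observations h))))
      = best_value - loss t" .
  thus ?case using Suc by (simp add: step distrib_left sum.distrib algebra_simps del: bandit_law.simps)
qed

text \<open>
The rewards of an arm differ from its number of plays times its mean reward only by the drift of the
compensated reward, which is a constant for every switch.
\<close>

lemma expected_total_reward:
  "\<bar>measure_pmf.expectation (dlaw t) (total_reward N)
     - (\<Sum>j=1..N. \<mu> j * measure_pmf.expectation (dlaw t) (\<lambda>h. plays (arm_past j h)))\<bar>
    \<le> N * (G * (1 + card (switch_times \<inter> {1..t})))"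
proof -
  let ?E = "measure_pmf.expectation (dlaw t)"
  have int: "integrable (measure_pmf (dlaw t)) f" for f :: "history \<Rightarrow> real"
    by (rule integrable_measure_pmf_finite[OF finite_law])
  have "?E (total_reward N) = (\<Sum>j=1..N. ?E (\<lambda>h. collected (arm_past j h)))"
    unfolding total_reward_eq_collected by (simp add: int)
  hence "\<bar>?E (total_reward N) - (\<Sum>j=1..N. \<mu> j * ?E (\<lambda>h. plays (arm_past j h)))\<bar>
      = \<bar>\<Sum>j=1..N. ?E (\<lambda>h. collected (arm_past j h)) - \<mu> j * ?E (\<lambda>h. plays (arm_past j h))\<bar>"
    by (simp add: sum_subtractf)
  also have "\<dots> \<le> (\<Sum>j=1..N. \<bar>?E (\<lambda>h. collected (arm_past j h)) - \<mu> j * ?E (\<lambda>h. plays (arm_past j h))\<bar>)"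
    by (rule sum_abs)
  also have "\<dots> \<le> (\<Sum>j=1..N. G * (1 + card (switch_times \<inter> {1..t})))"
  proof (rule sum_mono)
    fix j assume j: "j \<in> {1..N}"
    interpret poisson_arm N S P \<iota> Q j "g j" "\<mu> j" G policy switch_times
      by (rule poisson_arm_dsee[OF j])
    have "?E (\<lambda>h. collected (arm_past j h)) - \<mu> j * ?E (\<lambda>h. plays (arm_past j h))
        = ?E (\<lambda>h. compensated (\<mu> j) (g j) (arm_past j h)) - ?E (\<lambda>h. pending (\<mu> j) (g j) (arm_past j h))"
      unfolding compensated_def by (simp add: int)
    moreover have "\<bar>?E (\<lambda>h. pending (\<mu> j) (g j) (arm_past j h))\<bar> \<le> G"
      by (rule abs_expectation_le_finite[OF finite_law abs_pending_law])
    moreover have "\<bar>?E (\<lambda>h. compensated (\<mu> j) (g j) (arm_past j h))\<bar> \<le> G * card (switch_times \<inter> {1..t})"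
      using abs_expectation_compensated[of t] by (simp add: switch_count_def)
    ultimately show "\<bar>?E (\<lambda>h. collected (arm_past j h)) - \<mu> j * ?E (\<lambda>h. plays (arm_past j h))\<bar>
        \<le> G * (1 + card (switch_times \<inter> {1..t}))"
      by (simp add: distrib_left)
  qed
  finally show ?thesis by simp
qed

lemma regret_order:
  "(\<lambda>t. real t * best_value - measure_pmf.expectation (dlaw t) (total_reward N))
    \<in> O(\<lambda>t. D t * ln (real t))"
proof -
  obtain K where K0: "K \<ge> 0" and K: "\<And>t. 0 < t \<Longrightarrow> 0 \<le> D t \<Longrightarrow>
      \<bar>\<Sum>i<t. loss i\<bar> \<le> K * (1 + ln (real t)) + K * (D t * ln (real t) + 1)"
    using loss_sum_bound by blast
  have bound: "\<bar>real t * best_value - measure_pmf.expectation (dlaw t) (total_reward N)\<bar>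
      \<le> (4 * K + N * (G * (1 + 10 * real B))) * \<bar>D t * ln (real t)\<bar>" if t: "3 \<le> t" and D: "1 \<le> D t" for t
  proof -
    let ?X = "D t * ln (real t)"
    have "exp 1 \<le> real t" using t exp_le by linarith
    hence ln1: "1 \<le> ln (real t)" using t by (subst ln_ge_iff) auto
    have lnX: "ln (real t) \<le> ?X" using mult_right_mono[OF D, of "ln (real t)"] ln1 by simp
    have "\<bar>real t * best_value - measure_pmf.expectation (dlaw t) (total_reward N)\<bar>
        \<le> \<bar>\<Sum>i<t. loss i\<bar> + N * (G * (1 + card (switch_times \<inter> {1..t})))"
      using expected_total_reward[of t] pseudo_regret[of t] by linarith
    also have "\<dots> \<le> K * (4 * ?X) + N * (G * ((1 + 10 * real B) * ?X))"
    proof (intro add_mono mult_left_mono)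
      have "K * (1 + ln (real t)) + K * (?X + 1) \<le> K * (4 * ?X)"
        unfolding distrib_left[symmetric] by (intro mult_left_mono K0) (use lnX ln1 in linarith)
      thus "\<bar>\<Sum>i<t. loss i\<bar> \<le> K * (4 * ?X)" using K[of t] t D by simp
      have "8 + 2 * ln (real t) \<le> 10 * ?X" using lnX ln1 by linarith
      hence "real B * (8 + 2 * ln (real t)) \<le> real B * (10 * ?X)"
        by (rule mult_left_mono) simp
      hence "real (card (switch_times \<inter> {1..t})) \<le> real B * (10 * ?X)"
        using switch_times_bound[of t] by linarith
      moreover have "(1 + 10 * real B) * ?X = ?X + real B * (10 * ?X)" by (simp add: algebra_simps)
      ultimately show "real (1 + card (switch_times \<inter> {1..t})) \<le> (1 + 10 * real B) * ?X"
        unfolding of_nat_add of_nat_1 using lnX ln1 by linarith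
    qed (use G in auto)
    also have "\<dots> = (4 * K + N * (G * (1 + 10 * real B))) * \<bar>?X\<bar>"
      using lnX ln1 by (simp add: algebra_simps)
    finally show ?thesis .
  qed
  have "\<forall>\<^sub>F t in at_top. 1 \<le> D t" using D_lim by (auto simp: filterlim_at_top)
  hence "\<forall>\<^sub>F t in at_top. norm (real t * best_value - measure_pmf.expectation (dlaw t) (total_reward N))
      \<le> (4 * K + N * (G * (1 + 10 * real B))) * norm (D t * ln (real t))"
    using eventually_ge_at_top[of 3] by eventually_elim (use bound in simp)
  thus ?thesis by (rule bigoI)
qed

end

theorem theorem4:
  fixes N M :: nat
    and S :: "nat \<Rightarrow> real set"
    and P :: "nat \<Rightarrow> real \<Rightarrow> real pmf"
    and \<pi> :: "nat \<Rightarrow> real pmf"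
    and \<mu> :: "nat \<Rightarrow> real"
    and \<sigma> :: "nat \<Rightarrow> nat"
    and \<iota> :: "nat \<Rightarrow> real pmf"
    and Q :: "nat \<Rightarrow> (real \<times> bool) list \<Rightarrow> real pmf"
    and f :: "nat \<Rightarrow> real"
    and block :: "nat \<Rightarrow> nat \<Rightarrow> nat"
    and best :: "observation list \<Rightarrow> nat set"
    and r :: "nat \<Rightarrow> real"
  assumes "1 < M" and "M < N"
    and "\<And>j. j \<in> {1..N} \<Longrightarrow> finite (S j) \<and> S j \<noteq> {}"
    and "\<And>j s. j \<in> {1..N} \<Longrightarrow> s \<in> S j \<Longrightarrow> 0 \<le> s"
    and "\<And>j. j \<in> {1..N} \<Longrightarrow> transition_matrix (S j) (P j)"
    and "\<And>j. j \<in> {1..N} \<Longrightarrow> irreducible_chain (S j) (P j)"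
    and "\<And>j. j \<in> {1..N} \<Longrightarrow> aperiodic_chain (S j) (P j)"
    and "\<And>j. j \<in> {1..N} \<Longrightarrow> stationary_distribution (S j) (P j) (\<pi> j)"
    and "\<And>j. j \<in> {1..N} \<Longrightarrow> reversible_chain (S j) (P j) (\<pi> j)"
    and "\<And>j. j \<in> {1..N} \<Longrightarrow> set_pmf (\<iota> j) \<subseteq> S j"
    and "\<And>j p. j \<in> {1..N} \<Longrightarrow> set_pmf (Q j p) \<subseteq> S j"
    and "\<And>j. j \<in> {1..N} \<Longrightarrow> \<mu> j = mean_reward (S j) (\<pi> j)"
    and "\<sigma> permutes {1..N}"
    and "\<And>i j. 1 \<le> i \<Longrightarrow> i \<le> j \<Longrightarrow> j \<le> N \<Longrightarrow> \<mu> (\<sigma> j) \<le> \<mu> (\<sigma> i)"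
    and "mono_on {1..} f"
    and "filterlim f at_top at_top"
    and "block_assignment N M block"
    and "best_selection N M best"
    and "is_regret N M \<mu> \<sigma> \<iota> P Q (dsee N M f block best) r"
  shows "r \<in> O(\<lambda>t. f t * ln (real t))"
proof -
  have fin: "finite (S j)" "S j \<noteq> {}" if "j \<in> {1..N}" for j using assms(3)[OF that] by auto
  have "\<exists>g. \<forall>x\<in>S j. g x - measure_pmf.expectation (P j x) g = x - \<mu> j" if j: "j \<in> {1..N}" for j
  proof -
    have \<pi>S: "set_pmf (\<pi> j) \<subseteq> S j" using assms(8)[OF j] by (simp add: stationary_distribution_def)
    have "(\<Sum>x\<in>S j. pmf (\<pi> j) x) = 1" using fin[OF j] \<pi>S by (intro sum_pmf_eq_1) auto
    hence "measure_pmf.expectation (\<pi> j) (\<lambda>x. x - \<mu> j) = 0"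
      unfolding expectation_eq_sum[OF fin(1)[OF j] \<pi>S] assms(12)[OF j] mean_reward_def
      by (simp add: left_diff_distrib sum_subtractf sum_distrib_left[symmetric])
    thus ?thesis
      using poisson_equation[OF fin[OF j] assms(5)[OF j] assms(6)[OF j] assms(8)[OF j], of "\<lambda>x. x - \<mu> j"]
      by metis
  qed
  then obtain g where g: "\<And>j x. j \<in> {1..N} \<Longrightarrow> x \<in> S j \<Longrightarrow>
      g j x - measure_pmf.expectation (P j x) (g j) = x - \<mu> j"
    by metis
  \<comment> \<open>The summand 1 makes the common bound of the solutions positive.\<close>
  define G where "G = 1 + (\<Sum>j\<in>{1..N}. \<Sum>x\<in>S j. \<bar>g j x\<bar>)"
  have G: "\<bar>g j x\<bar> \<le> G" if "j \<in> {1..N}" "x \<in> S j" for j x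
  proof -
    have "\<bar>g j x\<bar> \<le> (\<Sum>x\<in>S j. \<bar>g j x\<bar>)" using that fin by (intro member_le_sum) auto
    also have "\<dots> \<le> (\<Sum>j\<in>{1..N}. \<Sum>x\<in>S j. \<bar>g j x\<bar>)"
      using that by (intro member_le_sum[of j "{1..N}" "\<lambda>j. \<Sum>x\<in>S j. \<bar>g j x\<bar>"]) (auto intro: sum_nonneg)
    finally show ?thesis by (simp add: G_def)
  qed
  have G_pos: "0 < G" unfolding G_def by (intro add_pos_nonneg sum_nonneg) auto
  interpret dsee_bandit N S P \<iota> Q M f block best \<mu> \<sigma> g G
  proof unfold_locales
    show "block_assignment N M block" "mono_on {1..} f" "filterlim f at_top at_top"
      "best_selection N M best" "\<sigma> permutes {1..N}" "0 < M" "0 < N" "M \<le> N" "0 < G"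
      using assms G_pos by auto
    show "\<mu> (\<sigma> j) \<le> \<mu> (\<sigma> i)" if "1 \<le> i" "i \<le> j" "j \<le> N" for i j using assms(14)[OF that] .
    fix j assume j: "j \<in> {1..N}"
    show "finite (S j)" "transition_matrix (S j) (P j)" "set_pmf (\<iota> j) \<subseteq> S j"
      using fin assms j by auto
    show "set_pmf (Q j p) \<subseteq> S j" for p using assms(11)[OF j] .
    fix x assume x: "x \<in> S j"
    show "g j x - measure_pmf.expectation (P j x) (g j) = x - \<mu> j" "\<bar>g j x\<bar> \<le> G"
      using g[OF j x] G[OF j x] .
  qed
  let ?\<rho> = "\<lambda>t. real t * (\<Sum>i=1..M. \<mu> (\<sigma> i)) - measure_pmf.expectation
      (bandit_law N \<iota> P Q (dsee N M f block best) t) (total_reward N)"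
  have "\<forall>\<^sub>F t in at_top. 1 \<le> f t" using assms(16) by (auto simp: filterlim_at_top)
  hence "\<forall>\<^sub>F t in at_top. norm (1::real) \<le> 1 * norm (f t * ln (real t))"
    using eventually_ge_at_top[of 3]
  proof eventually_elim
    case (elim t)
    have "exp 1 \<le> real t" using elim exp_le by linarith
    hence "1 \<le> ln (real t)" using elim by (subst ln_ge_iff) auto
    thus ?case using elim mult_mono[of 1 "f t" 1 "ln (real t)"] by simp
  qed
  hence one: "(\<lambda>_. 1) \<in> O(\<lambda>t. f t * ln (real t))" by (rule bigoI)
  have "(\<lambda>t. r t - ?\<rho> t) \<in> O(\<lambda>_. 1)" using assms(19) by (simp add: is_regret_def)
  hence "(\<lambda>t. r t - ?\<rho> t) \<in> O(\<lambda>t. f t * ln (real t))" using one by (rule landau_o.big_trans)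
  from sum_in_bigo(1)[OF this regret_order] show ?thesis by simp
qed

end
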